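(* Let $V=(-H_{x_2},H_{x_1})$ be the cellular flow on $\mathbb T^2$ with stream function $H(x_1,x_2)=\sin 2\pi x_1\,\sin 2\pi x_2$, and let $f$ be a KPP nonlinearity. Then, for all $p\in\mathbb R^2$ with $|p|=1$, $$\gamma_A(p),\ \beta_A(p)=O\left(\frac{A}{\log(A)}\right)\quad\text{as }A\to+\infty.$$
   Context: $\mathbb T^2=\mathbb R^2/\mathbb Z^2$; functions on it are $\mathbb Z^2$-periodic functions on $\mathbb R^2$. KPP nonlinearity: $f\in C^{1,\epsilon}([0,1])$ for some $\epsilon>0$, $f(0)=f(1)=0$, $f$ is non-increasing on $(1-\epsilon,1)$, and $0<f(s)\le s f'(0)$ for $s\in(0,1)$. For $A>0$ and $p\in\mathbb R^2$, $\beta_A(p)$ is the unique number such that $|p+DF|^2+AV(x)\cdot(p+DF)=\beta_A(p)$ admits a periodic viscosity solution. It is given by $\beta_A(p)=\inf_{\phi\in C^1(\mathbb T^2)}\max_{\mathbb T^2}\{|p+D\phi|^2+AV\cdot(p+D\phi)\}$. Also $\gamma_A(p)=\inf_{\lambda>0}\frac{f'(0)+\beta_A(\lambda p)}{\lambda}$ (F-equation flame speed). *)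

theory Defs
  imports "HOL-Analysis.Analysis" "HOL-Library.Landau_Symbols"
begin

definition deriv01 :: "(real \<Rightarrow> real) \<Rightarrow> real \<Rightarrow> real" where
  "deriv01 f s = vector_derivative f (at s within {0..1})"

text \<open>For \<open>\<epsilon> > 1\<close> the Hoelder condition would force the derivative to be constant, so
  \<open>\<epsilon> \<le> 1\<close> excludes no nonlinearity; it keeps the interval \<open>(1 - \<epsilon>, 1)\<close> inside \<open>[0, 1]\<close>.\<close>

definition C1_Hoelder01 :: "real \<Rightarrow> (real \<Rightarrow> real) \<Rightarrow> bool" where
  "C1_Hoelder01 \<epsilon> f \<longleftrightarrow>
     f differentiable_on {0..1} \<and>
     (\<exists>C. \<forall>s\<in>{0..1}. \<forall>t\<in>{0..1}. \<bar>deriv01 f s - deriv01 f t\<bar> \<le> C * \<bar>s - t\<bar> powr \<epsilon>)"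

definition KPP_nonlinearity :: "(real \<Rightarrow> real) \<Rightarrow> bool" where
  "KPP_nonlinearity f \<longleftrightarrow>
     (\<exists>\<epsilon>. 0 < \<epsilon> \<and> \<epsilon> \<le> 1 \<and> C1_Hoelder01 \<epsilon> f \<and> monotone_on {1 - \<epsilon><..<1} (\<le>) (\<ge>) f) \<and>
     f 0 = 0 \<and> f 1 = 0 \<and>
     (\<forall>s\<in>{0<..<1}. 0 < f s \<and> f s \<le> s * deriv01 f 0)"

definition torus_periodic :: "(real^2 \<Rightarrow> 'b) \<Rightarrow> bool" where
  "torus_periodic F \<longleftrightarrow> (\<forall>x k. (\<forall>i. k $ i \<in> \<int>) \<longrightarrow> F (x + k) = F x)"

definition C1_with_gradient :: "(real^2 \<Rightarrow> real) \<Rightarrow> (real^2 \<Rightarrow> real^2) \<Rightarrow> bool" where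
  "C1_with_gradient \<phi> g \<longleftrightarrow>
     continuous_on UNIV g \<and> (\<forall>x. (\<phi> has_derivative (\<lambda>h. g x \<bullet> h)) (at x))"

text \<open>Viscosity solutions of \<open>G(x, DF) = c\<close>, in the usual sign convention for \<open>G(x, DF) - c = 0\<close>:
  \<open>G \<le> c\<close> is tested where a \<open>C\<^sup>1\<close> function touches \<open>F\<close> from above.\<close>

definition viscosity_subsolution ::
    "(real^2 \<Rightarrow> real^2 \<Rightarrow> real) \<Rightarrow> real \<Rightarrow> (real^2 \<Rightarrow> real) \<Rightarrow> bool" where
  "viscosity_subsolution G c F \<longleftrightarrow>
     (\<forall>\<phi> g x. C1_with_gradient \<phi> g \<and> (\<forall>\<^sub>F y in nhds x. F y - \<phi> y \<le> F x - \<phi> x)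
        \<longrightarrow> G x (g x) \<le> c)"

definition viscosity_supersolution ::
    "(real^2 \<Rightarrow> real^2 \<Rightarrow> real) \<Rightarrow> real \<Rightarrow> (real^2 \<Rightarrow> real) \<Rightarrow> bool" where
  "viscosity_supersolution G c F \<longleftrightarrow>
     (\<forall>\<phi> g x. C1_with_gradient \<phi> g \<and> (\<forall>\<^sub>F y in nhds x. F y - \<phi> y \<ge> F x - \<phi> x)
        \<longrightarrow> G x (g x) \<ge> c)"

definition viscosity_solution ::
    "(real^2 \<Rightarrow> real^2 \<Rightarrow> real) \<Rightarrow> real \<Rightarrow> (real^2 \<Rightarrow> real) \<Rightarrow> bool" where
  "viscosity_solution G c F \<longleftrightarrow>
     continuous_on UNIV F \<and> viscosity_subsolution G c F \<and> viscosity_supersolution G c F"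

text \<open>\<open>\<beta>\<^sub>A(p)\<close>: for continuous periodic \<open>V\<close> the Hamiltonian is coercive in the momentum, so exactly
  one constant \<open>c\<close> admits a periodic viscosity solution.\<close>

definition effective_hamiltonian :: "(real^2 \<Rightarrow> real^2) \<Rightarrow> real \<Rightarrow> real^2 \<Rightarrow> real" where
  "effective_hamiltonian V A p =
     (THE c. \<exists>F. torus_periodic F \<and>
        viscosity_solution (\<lambda>x q. (norm (p + q))\<^sup>2 + A * (V x \<bullet> (p + q))) c F)"

text \<open>\<open>\<gamma>\<^sub>A(p)\<close>, the flame speed of the F-equation.\<close>

definition flame_speed ::
    "(real \<Rightarrow> real) \<Rightarrow> (real^2 \<Rightarrow> real^2) \<Rightarrow> real \<Rightarrow> real^2 \<Rightarrow> real" where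
  "flame_speed f V A p =
     (INF l\<in>{0<..}. (deriv01 f 0 + effective_hamiltonian V A (l *\<^sub>R p)) / l)"

definition partial_deriv :: "2 \<Rightarrow> (real^2 \<Rightarrow> real) \<Rightarrow> real^2 \<Rightarrow> real" where
  "partial_deriv i H x = frechet_derivative H (at x) (axis i 1)"

definition stream_flow :: "(real^2 \<Rightarrow> real) \<Rightarrow> real^2 \<Rightarrow> real^2" where
  "stream_flow H x = vector [- partial_deriv 2 H x, partial_deriv 1 H x]"

definition cellular_stream :: "real^2 \<Rightarrow> real" where
  "cellular_stream x = sin (2 * pi * x $ 1) * sin (2 * pi * x $ 2)"

definition cellular_flow :: "real^2 \<Rightarrow> real^2" where
  "cellular_flow = stream_flow cellular_stream"

end

theory Submission
  imports Defs "HOL-Complex_Analysis.Great_Picard" "HOL-Real_Asymp.Real_Asymp"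
begin

text \<open>For every coercive periodic Hamiltonian the cell problem is solvable, by Perron's method for
  the discounted equation and a vanishing discount limit; doubling of variables compares sub- and
  supersolutions, so the ergodic constant is unique and lies below every \<open>c\<close> that admits a
  subsolution. At a stagnation point of the flow the Hamiltonian is non-negative, so \<open>\<beta>\<^sub>A \<ge> 0\<close>.
  For the upper bound take \<open>u(x) = p\<^sub>1 U(x\<^sub>1) + p\<^sub>2 U(x\<^sub>2)\<close> where \<open>U(t + 1) = U(t) + 1\<close> and
  \<open>U' = const / (\<epsilon> + \<bar>sin 2\<pi>t\<bar>)\<close>, the constant being \<open>O(1 / ln (1/\<epsilon>))\<close>. Then
  \<open>V \<bullet> Du = O(1 / ln (1/\<epsilon>))\<close> and \<open>\<bar>Du\<bar> = O(1 / (\<epsilon> ln (1/\<epsilon>)))\<close>, and \<open>\<epsilon> = A\<^bsup>-1/2\<^esup>\<close>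
  gives \<open>\<beta>\<^sub>A(p) = O(A / ln A)\<close>. Finally \<open>0 \<le> \<gamma>\<^sub>A(p) \<le> f'(0) + \<beta>\<^sub>A(p)\<close>, by \<open>\<lambda> = 1\<close>.\<close>

subsection \<open>Superdifferentials\<close>

text \<open>The subdifferential of \<open>F\<close> is \<open>- superdiff (- F)\<close>, so supersolutions are treated through \<open>- F\<close>.\<close>

definition superdiff :: "(real^2 \<Rightarrow> real) \<Rightarrow> real^2 \<Rightarrow> (real^2) set" where
  "superdiff F x = {q. \<exists>\<phi> g. C1_with_gradient \<phi> g \<and> g x = q \<and>
     (\<forall>\<^sub>F y in nhds x. F y - \<phi> y \<le> F x - \<phi> x)}"

lemma superdiffI:
  assumes "C1_with_gradient \<phi> g" "g x = q" "\<forall>\<^sub>F y in nhds x. F y - \<phi> y \<le> F x - \<phi> x"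
  shows "q \<in> superdiff F x"
  using assms unfolding superdiff_def by blast

section \<open>Arithmetic of continuously differentiable test functions\<close>

lemma C1_with_gradient_diff:
  assumes "C1_with_gradient \<phi> g" "C1_with_gradient \<psi> h"
  shows "C1_with_gradient (\<lambda>x. \<phi> x - \<psi> x) (\<lambda>x. g x - h x)"
  using assms unfolding C1_with_gradient_def
  by (auto intro!: continuous_intros has_derivative_eq_rhs[OF has_derivative_diff]
      simp: inner_diff_left)

lemma C1_with_gradient_const: "C1_with_gradient (\<lambda>x. c) (\<lambda>x. 0)"
  unfolding C1_with_gradient_def by (auto intro!: derivative_eq_intros)

lemma C1_with_gradient_uminus:
  "C1_with_gradient \<phi> g \<Longrightarrow> C1_with_gradient (\<lambda>x. - \<phi> x) (\<lambda>x. - g x)"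
  using C1_with_gradient_diff[OF C1_with_gradient_const[of 0]] by fastforce

lemma C1_with_gradient_add:
  assumes "C1_with_gradient \<phi> g" "C1_with_gradient \<psi> h"
  shows "C1_with_gradient (\<lambda>x. \<phi> x + \<psi> x) (\<lambda>x. g x + h x)"
  using C1_with_gradient_diff[OF assms(1) C1_with_gradient_uminus[OF assms(2)]] by simp

lemma C1_with_gradient_quadratic:
  "C1_with_gradient (\<lambda>y. a * (norm (y - x))\<^sup>2) (\<lambda>y. (2 * a) *\<^sub>R (y - x))"
  unfolding C1_with_gradient_def power2_norm_eq_inner
  by (auto intro!: continuous_intros derivative_eq_intros simp: inner_commute algebra_simps)

lemma C1_with_gradient_isCont: "C1_with_gradient \<phi> g \<Longrightarrow> isCont \<phi> x"
  unfolding C1_with_gradient_def using has_derivative_continuous by blast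

lemma C1_with_gradient_continuous_on: "C1_with_gradient \<phi> g \<Longrightarrow> continuous_on S \<phi>"
  by (simp add: C1_with_gradient_isCont continuous_at_imp_continuous_on)

section \<open>Superdifferentials and touching functions\<close>

text \<open>\<open>\<psi>\<close> touches \<open>F\<close> from below at \<open>x\<close> and a test
  function \<open>\<phi>\<close> touches it from above, so \<open>\<psi> - \<phi>\<close> has a
  local maximum at \<open>x\<close> and its gradient vanishes there.\<close>

lemma superdiff_eq_gradient:
  assumes "C1_with_gradient \<psi> h" "q \<in> superdiff F x"
    and ge: "\<forall>\<^sub>F y in nhds x. \<psi> y \<le> F y" and "\<psi> x = F x"
  shows "q = h x"
proof -
  obtain \<phi> g where \<phi>: "C1_with_gradient \<phi> g" "g x = q"
      "\<forall>\<^sub>F y in nhds x. F y - \<phi> y \<le> F x - \<phi> x"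
    using assms(2) unfolding superdiff_def by blast
  have "\<forall>\<^sub>F y in nhds x. \<psi> y - \<phi> y \<le> \<psi> x - \<phi> x"
    using ge \<phi>(3) by eventually_elim (use \<open>\<psi> x = F x\<close> in linarith)
  then have "\<forall>\<^sub>F y in at x. \<psi> y - \<phi> y \<le> \<psi> x - \<phi> x"
    using eventually_nhds_conv_at by blast
  moreover have "((\<lambda>y. \<psi> y - \<phi> y) has_derivative (\<lambda>v. (h x - g x) \<bullet> v)) (at x)"
    using C1_with_gradient_diff[OF assms(1) \<phi>(1)] unfolding C1_with_gradient_def by blast
  ultimately have "(\<lambda>v. (h x - g x) \<bullet> v) = (\<lambda>v. 0)"
    using has_derivative_local_max by blast
  then have "(h x - g x) \<bullet> (h x - g x) = 0" by (rule fun_cong)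
  then show ?thesis using \<phi>(2) by simp
qed

lemma superdiff_antimono:
  assumes "q \<in> superdiff F x" "\<forall>\<^sub>F y in nhds x. v y \<le> F y" "v x = F x"
  shows "q \<in> superdiff v x"
proof -
  obtain \<phi> g where \<phi>: "C1_with_gradient \<phi> g" "g x = q"
      "\<forall>\<^sub>F y in nhds x. F y - \<phi> y \<le> F x - \<phi> x"
    using assms(1) unfolding superdiff_def by blast
  have "\<forall>\<^sub>F y in nhds x. v y - \<phi> y \<le> v x - \<phi> x"
    using assms(2) \<phi>(3) by eventually_elim (use assms(3) in linarith)
  then show ?thesis using \<phi> superdiffI by blast
qed

text \<open>Makes the Perron competitors invariant under lattice translations.\<close>

lemma superdiff_translate:
  assumes "q \<in> superdiff (\<lambda>y. F (y + k)) x"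
  shows "q \<in> superdiff F (x + k)"
proof -
  obtain \<phi> g where \<phi>: "C1_with_gradient \<phi> g" "g x = q"
      "\<forall>\<^sub>F y in nhds x. F (y + k) - \<phi> y \<le> F (x + k) - \<phi> x"
    using assms unfolding superdiff_def by blast
  have "C1_with_gradient (\<lambda>y. \<phi> (y - k)) (\<lambda>y. g (y - k))"
    unfolding C1_with_gradient_def
  proof safe
    have "continuous_on UNIV g" using \<phi>(1) by (simp add: C1_with_gradient_def)
    then show "continuous_on UNIV (\<lambda>y. g (y - k))"
      by (rule continuous_on_compose2) (auto intro: continuous_intros)
    fix z
    have "(\<phi> has_derivative (\<lambda>h. g (z - k) \<bullet> h)) (at (z - k))"
      using \<phi>(1) by (simp add: C1_with_gradient_def)
    moreover have "((\<lambda>y. y - k) has_derivative (\<lambda>h. h)) (at z)"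
      by (auto intro!: derivative_eq_intros)
    ultimately show "((\<lambda>y. \<phi> (y - k)) has_derivative (\<lambda>h. g (z - k) \<bullet> h)) (at z)"
      using has_derivative_compose by blast
  qed
  moreover have "filterlim (\<lambda>y. y - k) (nhds x) (nhds (x + k))"
    by (auto intro!: tendsto_eq_intros filterlim_ident)
  then have "\<forall>\<^sub>F y in nhds (x + k). F y - \<phi> (y - k) \<le> F (x + k) - \<phi> (x + k - k)"
    using \<phi>(3) by (auto simp: filterlim_iff)
  ultimately show ?thesis
    using \<phi>(2) by (intro superdiffI[of "\<lambda>y. \<phi> (y - k)" "\<lambda>y. g (y - k)"]) auto
qed

lemma viscosity_subsolution_iff:
  "viscosity_subsolution G c F \<longleftrightarrow> (\<forall>x. \<forall>q\<in>superdiff F x. G x q \<le> c)"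
  unfolding viscosity_subsolution_def superdiff_def by blast

lemma viscosity_supersolution_iff:
  "viscosity_supersolution G c F \<longleftrightarrow> (\<forall>x. \<forall>q\<in>superdiff (\<lambda>y. - F y) x. G x (- q) \<ge> c)"
proof safe
  fix x q assume F: "viscosity_supersolution G c F" and "q \<in> superdiff (\<lambda>y. - F y) x"
  then obtain \<phi> g where \<phi>: "C1_with_gradient \<phi> g" "g x = q"
      "\<forall>\<^sub>F y in nhds x. - F y - \<phi> y \<le> - F x - \<phi> x"
    unfolding superdiff_def by blast
  have "\<forall>\<^sub>F y in nhds x. F y - - \<phi> y \<ge> F x - - \<phi> x"
    using \<phi>(3) by eventually_elim simp
  then show "G x (- q) \<ge> c"
    using F C1_with_gradient_uminus[OF \<phi>(1)] \<phi>(2) unfolding viscosity_supersolution_def by blast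
next
  assume *: "\<forall>x. \<forall>q\<in>superdiff (\<lambda>y. - F y) x. G x (- q) \<ge> c"
  show "viscosity_supersolution G c F"
    unfolding viscosity_supersolution_def
  proof safe
    fix \<phi> g x assume \<phi>: "C1_with_gradient \<phi> g" "\<forall>\<^sub>F y in nhds x. F y - \<phi> y \<ge> F x - \<phi> x"
    have "\<forall>\<^sub>F y in nhds x. - F y - - \<phi> y \<le> - F x - - \<phi> x"
      using \<phi>(2) by eventually_elim simp
    then have "- g x \<in> superdiff (\<lambda>y. - F y) x"
      by (intro superdiffI[OF C1_with_gradient_uminus[OF \<phi>(1)]]) auto
    then show "G x (g x) \<ge> c" using * by fastforce
  qed
qed

section \<open>Density and stability of superdifferentials, Lipschitz bounds\<close>

lemma isCont_eventually_dist:
  fixes f :: "'a::metric_space \<Rightarrow> 'b::metric_space"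
  shows "isCont f x \<Longrightarrow> 0 < e \<Longrightarrow> \<forall>\<^sub>F y in nhds x. dist (f y) (f x) < e"
  unfolding isCont_def tendsto_at_iff_tendsto_nhds by (rule tendstoD)

text \<open>\<open>F\<close> minus a steep paraboloid centred at \<open>x\<close> attains its
  maximum over the ball in the interior, and there the paraboloid is a test function.\<close>

lemma superdiff_dense:
  assumes "continuous_on UNIV F" "0 < r"
  obtains y where "dist y x < r" "superdiff F y \<noteq> {}"
proof -
  have "compact (F ` cball x r)"
    using assms by (meson compact_cball compact_continuous_image continuous_on_subset subset_UNIV)
  then obtain M where M: "\<And>y. y \<in> cball x r \<Longrightarrow> \<bar>F y\<bar> \<le> M"
    by (metis compact_imp_bounded bounded_iff imageI real_norm_def)
  \<comment> \<open>On the sphere of radius \<open>r\<close> the penalty is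
    \<open>2 * M + 1\<close>, more than \<open>F\<close> can vary, so the maximiser stays off the
    sphere.\<close>
  define a where "a = (2 * M + 1) / r\<^sup>2"
  have "continuous_on (cball x r) (\<lambda>y. F y - a * (norm (y - x))\<^sup>2)"
    by (intro continuous_intros continuous_on_subset[OF assms(1)]) auto
  then obtain y where y: "y \<in> cball x r"
      and max: "\<And>z. z \<in> cball x r \<Longrightarrow> F z - a * (norm (z - x))\<^sup>2 \<le> F y - a * (norm (y - x))\<^sup>2"
    using continuous_attains_sup[of "cball x r" "\<lambda>y. F y - a * (norm (y - x))\<^sup>2"] assms(2) by auto
  have "dist y x \<noteq> r"
  proof
    assume "dist y x = r"
    then have "a * (norm (y - x))\<^sup>2 = 2 * M + 1"
      using assms(2) by (simp add: a_def dist_norm)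
    moreover have "F x - a * (norm (x - x))\<^sup>2 \<le> F y - a * (norm (y - x))\<^sup>2"
      using assms(2) by (intro max) auto
    ultimately show False
      using M[OF y] M[of x] assms(2) by auto
  qed
  then have yr: "dist y x < r" using y by (auto simp: dist_commute)
  then have "\<forall>\<^sub>F z in nhds y. z \<in> ball x r"
    by (intro eventually_nhds_in_open) (auto simp: dist_commute)
  then have "\<forall>\<^sub>F z in nhds y. F z - a * (norm (z - x))\<^sup>2 \<le> F y - a * (norm (y - x))\<^sup>2"
    by eventually_elim (use max in auto)
  then show ?thesis
    using that[OF yr] superdiffI[OF C1_with_gradient_quadratic] by blast
qed

text \<open>Adding the squared distance from \<open>x\<close> to the test function makes the maximum
  strict, so that it survives the passage from \<open>F\<close> to \<open>v\<close>. Closeness from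
  below is asked at \<open>x\<close> only: a Perron competitor comes near the supremum at one chosen
  point.\<close>

lemma superdiff_stable:
  assumes F: "continuous_on UNIV F" and q: "q \<in> superdiff F x" and "0 < e"
  obtains d where "0 < d"
    "\<And>v. \<lbrakk>continuous_on UNIV v; \<And>y. dist y x < e \<Longrightarrow> v y \<le> F y + d; F x - d \<le> v x\<rbrakk>
      \<Longrightarrow> \<exists>y. \<exists>r\<in>superdiff v y. dist y x < e \<and> \<bar>v y - F x\<bar> < e \<and> dist r q < e"
proof -
  obtain \<phi> g where \<phi>: "C1_with_gradient \<phi> g" "g x = q"
      "\<forall>\<^sub>F y in nhds x. F y - \<phi> y \<le> F x - \<phi> x"
    using q unfolding superdiff_def by blast
  have "\<forall>\<^sub>F y in nhds x. dist (F y) (F x) < e/4"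
    using F \<open>0 < e\<close> by (intro isCont_eventually_dist) (auto simp: continuous_on_eq_continuous_at)
  moreover have "\<forall>\<^sub>F y in nhds x. dist (\<phi> y) (\<phi> x) < e/4"
    using \<open>0 < e\<close> by (intro isCont_eventually_dist C1_with_gradient_isCont[OF \<phi>(1)]) auto
  moreover have "\<forall>\<^sub>F y in nhds x. dist (g y) (g x) < e/2"
    using \<phi>(1) \<open>0 < e\<close>
    by (intro isCont_eventually_dist) (auto simp: C1_with_gradient_def continuous_on_eq_continuous_at)
  ultimately have "\<forall>\<^sub>F y in nhds x. F y - \<phi> y \<le> F x - \<phi> x \<and> dist (F y) (F x) < e/4 \<and>
      dist (\<phi> y) (\<phi> x) < e/4 \<and> dist (g y) (g x) < e/2"
    using \<phi>(3) by eventually_elim simp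
  then obtain r0 where "0 < r0" and r0: "\<And>y. dist y x < r0 \<Longrightarrow> F y - \<phi> y \<le> F x - \<phi> x \<and>
      dist (F y) (F x) < e/4 \<and> dist (\<phi> y) (\<phi> x) < e/4 \<and> dist (g y) (g x) < e/2"
    unfolding eventually_nhds_metric by blast
  \<comment> \<open>\<open>2 * r < e/2\<close> controls the gradient of the added square, and
    \<open>2 * d < r\<^sup>2\<close> will exclude a maximiser on the sphere.\<close>
  define r where "r = min (r0/2) (e/5)"
  have r: "0 < r" "r < r0" "r < e" "2 * r < e/2"
    using \<open>0 < r0\<close> \<open>0 < e\<close> by (auto simp: r_def)
  define d where "d = min (r\<^sup>2/4) (e/4)"
  have d: "0 < d" "2 * d < r\<^sup>2" "d \<le> e/4"
    using r \<open>0 < e\<close> by (auto simp: d_def min_def)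
  show ?thesis
  proof
    show "0 < d" by fact
    fix v assume v: "continuous_on UNIV v" "\<And>y. dist y x < e \<Longrightarrow> v y \<le> F y + d" "F x - d \<le> v x"
    define \<psi> where "\<psi> y = \<phi> y + 1 * (norm (y - x))\<^sup>2" for y
    define h where "h y = g y + (2 * 1) *\<^sub>R (y - x)" for y
    have \<psi>: "C1_with_gradient \<psi> h"
      unfolding \<psi>_def h_def by (intro C1_with_gradient_add \<phi> C1_with_gradient_quadratic)
    have "continuous_on (cball x r) (\<lambda>y. v y - \<psi> y)"
      by (intro continuous_intros continuous_on_subset[OF v(1)] C1_with_gradient_continuous_on[OF \<psi>]) auto
    then obtain y where y: "y \<in> cball x r"
      and max: "\<And>z. z \<in> cball x r \<Longrightarrow> v z - \<psi> z \<le> v y - \<psi> y"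
      using continuous_attains_sup[of "cball x r" "\<lambda>y. v y - \<psi> y"] r by auto
    have yr: "dist y x \<le> r" using y by (simp add: dist_commute)
    note Y = r0[OF le_less_trans[OF yr r(2)]]
    have vy: "v y \<le> F y + d" using v(2) yr r by simp
    have vx: "v x - \<phi> x \<le> v y - \<phi> y - (norm (y - x))\<^sup>2"
      using max[of x] r by (simp add: \<psi>_def)
    have "dist y x \<noteq> r"
      using vx vy Y v(3) d by (auto simp: dist_norm)
    then have "dist y x < r" using yr by simp
    then have "\<forall>\<^sub>F z in nhds y. z \<in> ball x r"
      by (intro eventually_nhds_in_open) (auto simp: dist_commute)
    then have "\<forall>\<^sub>F z in nhds y. v z - \<psi> z \<le> v y - \<psi> y"
      by eventually_elim (use max in auto)
    then have "h y \<in> superdiff v y"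
      using superdiffI[OF \<psi>] by blast
    moreover have "dist y x < e" using yr r by simp
    moreover have "\<bar>v y - F x\<bar> < e"
    proof -
      have "v x - \<phi> x \<le> v y - \<phi> y" using vx zero_le_power2[of "norm (y - x)"] by linarith
      then show ?thesis
        using vy Y d v(3) \<open>0 < e\<close> unfolding dist_real_def by linarith
    qed
    moreover have "dist (h y) q < e"
    proof -
      have "norm (h y - q) \<le> norm (g y - q) + norm ((2::real) *\<^sub>R (y - x))"
        using norm_triangle_ineq[of "g y - q" "(2::real) *\<^sub>R (y - x)"] by (simp add: h_def algebra_simps)
      also have "\<dots> < e/2 + e/2"
        using Y yr r \<phi>(2) by (simp add: dist_norm)
      finally show ?thesis by (simp add: dist_norm)
    qed
    ultimately show "\<exists>y. \<exists>r\<in>superdiff v y. dist y x < e \<and> \<bar>v y - F x\<bar> < e \<and> dist r q < e"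
      by blast
  qed
qed

text \<open>If the bound failed, \<open>F\<close> minus a cone of slope \<open>L' > L\<close> with
  vertex \<open>x\<close> would have a maximum at some \<open>z \<noteq> x\<close>, where the
  gradient of the cone has norm \<open>L'\<close>, too large for the superdifferential.\<close>

lemma superdiff_bounded_imp_Lipschitz:
  assumes F: "continuous_on UNIV F" and M: "\<And>z. \<bar>F z\<bar> \<le> M"
    and L: "0 \<le> L" "\<And>z q. q \<in> superdiff F z \<Longrightarrow> norm q \<le> L"
  shows "F y - F x \<le> L * norm (y - x)"
proof (rule ccontr)
  assume "\<not> ?thesis"
  then have lt: "L * norm (y - x) < F y - F x" by simp
  then have "y \<noteq> x" by auto
  then obtain L' where L': "L < L'" "L' < (F y - F x) / norm (y - x)"
    using lt dense[of L "(F y - F x) / norm (y - x)"] by (auto simp: field_simps)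
  then have lt': "L' * norm (y - x) < F y - F x"
    using \<open>y \<noteq> x\<close> by (simp add: field_simps)
  have "0 < L'" using L L' by simp
  define \<Phi> where "\<Phi> z = F z - L' * norm (z - x)" for z
  \<comment> \<open>Outside this ball the cone outweighs any gain of \<open>F\<close> over its value
    at \<open>y\<close>, so the maximum over the ball is global.\<close>
  define R where "R = max (norm (y - x)) (2 * M / L' + norm (y - x))"
  have "continuous_on (cball x R) \<Phi>"
    unfolding \<Phi>_def by (intro continuous_intros continuous_on_subset[OF F]) auto
  moreover have yR: "y \<in> cball x R" by (simp add: R_def dist_norm norm_minus_commute)
  moreover have "0 \<le> R" by (simp add: R_def le_max_iff_disj)
  ultimately obtain z where z: "z \<in> cball x R" and max: "\<And>w. w \<in> cball x R \<Longrightarrow> \<Phi> w \<le> \<Phi> z"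
    using continuous_attains_sup[of "cball x R" \<Phi>] by auto
  have gmax: "\<Phi> w \<le> \<Phi> z" for w
  proof (cases "w \<in> cball x R")
    case False
    then have "2 * M / L' + norm (y - x) \<le> norm (w - x)"
      by (auto simp: R_def dist_norm norm_minus_commute)
    then have "L' * (2 * M / L' + norm (y - x)) \<le> L' * norm (w - x)"
      using \<open>0 < L'\<close> by (intro mult_left_mono) auto
    then have "\<Phi> w \<le> \<Phi> y"
      using M[of w] M[of y] \<open>0 < L'\<close> unfolding \<Phi>_def by (simp add: distrib_left abs_le_iff)
    then show ?thesis using max[OF yR] by simp
  qed (use max in auto)
  have "z \<noteq> x" using gmax[of y] lt' by (auto simp: \<Phi>_def)
  define s where "s = norm (z - x)"
  have "0 < s" using \<open>z \<noteq> x\<close> by (simp add: s_def)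
  \<comment> \<open>the cone is touched from above at \<open>z\<close> by this paraboloid, since \<open>r \<le> (r\<^sup>2/s + s)/2\<close>\<close>
  define \<psi> where "\<psi> w = L' / (2 * s) * (norm (w - x))\<^sup>2 + L' * s / 2" for w
  have C1: "C1_with_gradient \<psi> (\<lambda>w. (2 * (L' / (2 * s))) *\<^sub>R (w - x) + 0)"
    unfolding \<psi>_def by (intro C1_with_gradient_add C1_with_gradient_quadratic C1_with_gradient_const)
  have ge: "L' * norm (w - x) \<le> \<psi> w" for w
  proof -
    have "\<psi> w - L' * norm (w - x) = L' / (2 * s) * (norm (w - x) - s)\<^sup>2"
      using \<open>0 < s\<close> by (simp add: \<psi>_def power2_diff field_simps power2_eq_square)
    moreover have "0 \<le> L' / (2 * s) * (norm (w - x) - s)\<^sup>2"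
      using \<open>0 < L'\<close> \<open>0 < s\<close> by simp
    ultimately show ?thesis by linarith
  qed
  have eq: "\<psi> z = L' * norm (z - x)"
    using \<open>0 < s\<close> unfolding \<psi>_def s_def[symmetric] by (simp add: field_simps power2_eq_square)
  have "F w - \<psi> w \<le> F z - \<psi> z" for w
    using gmax[of w] ge[of w] eq by (simp add: \<Phi>_def)
  then have "(2 * (L' / (2 * s))) *\<^sub>R (z - x) + 0 \<in> superdiff F z"
    by (intro superdiffI[OF C1]) auto
  then have "norm ((2 * (L' / (2 * s))) *\<^sub>R (z - x) + 0) \<le> L" using L(2) by blast
  moreover have "norm ((2 * (L' / (2 * s))) *\<^sub>R (z - x) + 0) = L'"
    using \<open>0 < s\<close> \<open>0 < L'\<close> by (simp add: s_def)
  ultimately show False using L' by simp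
qed

section \<open>Viscosity inequalities: classical functions, reflection, uniform limits\<close>

lemma superdiff_minus_const: "superdiff (\<lambda>y. F y - c) x = superdiff F x"
  unfolding superdiff_def by (simp add: algebra_simps)

lemma viscosity_subsolution_C1:
  assumes "C1_with_gradient F g" "\<And>x. G x (g x) \<le> c"
  shows "viscosity_subsolution G c F"
  unfolding viscosity_subsolution_iff
  using superdiff_eq_gradient[OF assms(1)] assms(2) by (metis (mono_tags) always_eventually order_refl)

text \<open>By this reflection, stability under limits has to be proved for subsolutions
  only.\<close>

lemma viscosity_supersolution_iff_sub:
  "viscosity_supersolution G c F \<longleftrightarrow> viscosity_subsolution (\<lambda>x q. - G x (- q)) (- c) (\<lambda>x. - F x)"
  unfolding viscosity_supersolution_iff viscosity_subsolution_iff by simp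

text \<open>\<open>superdiff_stable\<close> replaces a superdifferential element of the limit by a
  nearby one of some \<open>v n\<close> at a nearby point; the inequality at level
  \<open>b n\<close> holds there, and continuity of \<open>K\<close> carries it back.\<close>

lemma viscosity_subsolution_limit:
  fixes v :: "nat \<Rightarrow> real^2 \<Rightarrow> real"
  assumes K: "continuous_on UNIV (\<lambda>(x, q). K x q)"
    and v: "\<And>n. continuous_on UNIV (v n)" "uniform_limit UNIV v u sequentially"
    and b: "b \<longlonglongrightarrow> c" and sub: "\<And>n. viscosity_subsolution K (b n) (v n)"
  shows "viscosity_subsolution K c u"
  unfolding viscosity_subsolution_iff
proof (intro allI ballI)
  fix x q assume q: "q \<in> superdiff u x"
  have u: "continuous_on UNIV u"
    using uniform_limit_theorem[OF _ v(2)] v(1) by simp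
  show "K x q \<le> c"
  proof (rule ccontr)
    assume "\<not> K x q \<le> c"
    \<comment> \<open>Half of the supposed excess: one half pays for the variation of
      \<open>K\<close>, the other for the distance of \<open>b n\<close> from
      \<open>c\<close>.\<close>
    define e0 where "e0 = (K x q - c) / 2"
    have "0 < e0" using \<open>\<not> K x q \<le> c\<close> by (simp add: e0_def)
    have "isCont (\<lambda>(x, q). K x q) (x, q)"
      using K by (simp add: continuous_on_eq_continuous_at)
    then have "\<forall>\<^sub>F z in nhds (x, q). dist ((\<lambda>(x, q). K x q) z) (K x q) < e0"
      using isCont_eventually_dist[of "(x, q)" "\<lambda>(x, q). K x q" e0] \<open>0 < e0\<close> by simp
    then obtain d where "0 < d"
      and d: "\<And>y r. dist (y, r) (x, q) < d \<Longrightarrow> \<bar>K y r - K x q\<bar> < e0"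
      unfolding eventually_nhds_metric by (fastforce simp: dist_real_def)
    obtain d' where "0 < d'" and d':
      "\<And>v. \<lbrakk>continuous_on UNIV v; \<And>y. dist y x < d/2 \<Longrightarrow> v y \<le> u y + d'; u x - d' \<le> v x\<rbrakk>
      \<Longrightarrow> \<exists>y. \<exists>r\<in>superdiff v y. dist y x < d/2 \<and> \<bar>v y - u x\<bar> < d/2 \<and> dist r q < d/2"
      using superdiff_stable[OF u q, of "d/2"] \<open>0 < d\<close> by (metis half_gt_zero)
    have "\<forall>\<^sub>F n in sequentially. \<forall>y\<in>UNIV. dist (v n y) (u y) < d'"
      using uniform_limitD[OF v(2) \<open>0 < d'\<close>] .
    moreover have "\<forall>\<^sub>F n in sequentially. dist (b n) c < e0"
      using tendstoD[OF b \<open>0 < e0\<close>] .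
    ultimately have "\<forall>\<^sub>F n in sequentially. (\<forall>y\<in>UNIV. dist (v n y) (u y) < d') \<and> dist (b n) c < e0"
      by (rule eventually_conj)
    then obtain n where n: "\<And>y. \<bar>v n y - u y\<bar> < d'" "\<bar>b n - c\<bar> < e0"
      using eventually_happens'[OF sequentially_bot] by (fastforce simp: dist_real_def)
    have "v n y \<le> u y + d'" "u y - d' \<le> v n y" for y
      using n(1)[of y] by auto
    then obtain y r where yr: "r \<in> superdiff (v n) y" "dist y x < d/2" "dist r q < d/2"
      using d'[OF v(1)[of n]] by blast
    have "dist (y, r) (x, q) \<le> dist y x + dist r q"
      by (metis dist_Pair_Pair dist_real_def real_sqrt_abs sqrt_sum_squares_le_sum zero_le_dist)
    then have "\<bar>K y r - K x q\<bar> < e0" using yr by (intro d) simp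
    moreover have "K y r \<le> b n" using sub yr(1) by (auto simp: viscosity_subsolution_iff)
    ultimately show False using n(2) unfolding e0_def by (simp add: abs_if field_simps split: if_splits)
  qed
qed

lemma viscosity_supersolution_limit:
  fixes v :: "nat \<Rightarrow> real^2 \<Rightarrow> real"
  assumes K: "continuous_on UNIV (\<lambda>(x, q). K x q)"
    and v: "\<And>n. continuous_on UNIV (v n)" "uniform_limit UNIV v u sequentially"
    and b: "b \<longlonglongrightarrow> c" and super: "\<And>n. viscosity_supersolution K (b n) (v n)"
  shows "viscosity_supersolution K c u"
  unfolding viscosity_supersolution_iff_sub
proof (rule viscosity_subsolution_limit)
  show "continuous_on UNIV (\<lambda>(x, q). - K x (- q))"
  proof -
    have "continuous_on UNIV (\<lambda>z. - (case (fst z, - snd z) of (x, q) \<Rightarrow> K x q))"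
      by (intro continuous_intros continuous_on_compose2[OF K]) auto
    then show ?thesis by (simp add: case_prod_beta')
  qed
  show "continuous_on UNIV (\<lambda>x. - v n x)" for n using v(1) by (intro continuous_intros)
  show "uniform_limit UNIV (\<lambda>n x. - v n x) (\<lambda>x. - u x) sequentially"
    by (intro uniform_limit_intros v(2))
  show "(\<lambda>n. - b n) \<longlonglongrightarrow> - c" by (intro tendsto_intros b)
  show "viscosity_subsolution (\<lambda>x q. - K x (- q)) (- b n) (\<lambda>x. - v n x)" for n
    using super[of n] unfolding viscosity_supersolution_iff_sub .
qed

subsection \<open>The cell problem\<close>

lemma torus_representative:
  fixes x :: "real^2"
  obtains k where "\<And>i. k $ i \<in> \<int>" "x + k \<in> cbox 0 1"
proof
  let ?k = "(\<chi> i. - of_int \<lfloor>x $ i\<rfloor>) :: real^2"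
  show "?k $ i \<in> \<int>" for i by simp
  show "x + ?k \<in> cbox 0 1"
    by (auto simp: mem_box_cart) linarith
qed

lemma torus_periodicD: "torus_periodic F \<Longrightarrow> (\<And>i. k $ i \<in> \<int>) \<Longrightarrow> F (x + k) = F x"
  unfolding torus_periodic_def by blast

lemma torus_periodic_bounded:
  fixes F :: "real^2 \<Rightarrow> real"
  assumes "continuous_on UNIV F" "torus_periodic F"
  obtains M where "\<And>x. \<bar>F x\<bar> \<le> M"
proof -
  have "compact (F ` cbox 0 1)"
    using assms(1) by (meson compact_cbox compact_continuous_image continuous_on_subset subset_UNIV)
  then obtain M where M: "\<And>y. y \<in> cbox 0 1 \<Longrightarrow> \<bar>F y\<bar> \<le> M"
    by (metis compact_imp_bounded bounded_iff imageI real_norm_def)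
  have "\<bar>F x\<bar> \<le> M" for x
    using torus_representative[of x] M torus_periodicD[OF assms(2)] by metis
  then show ?thesis using that by blast
qed

section \<open>Uniform estimates for coercive periodic Hamiltonians\<close>

locale coercive_hamiltonian =
  fixes G :: "real^2 \<Rightarrow> real^2 \<Rightarrow> real"
  assumes continuous: "continuous_on UNIV (\<lambda>(x, q). G x q)"
    and periodic: "torus_periodic (\<lambda>x. G x q)"
    and coercive: "\<exists>R\<ge>0. \<forall>x q. G x q \<le> c \<longrightarrow> norm q \<le> R"
begin

lemma bounded_on_cball:
  obtains M where "\<And>x q. norm q \<le> R \<Longrightarrow> \<bar>G x q\<bar> \<le> M"
proof -
  have "compact ((\<lambda>(x, q). G x q) ` (cbox 0 1 \<times> cball 0 R))"
    by (intro compact_continuous_image continuous_on_subset[OF continuous] compact_Times) auto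
  then obtain M where M: "\<And>y. y \<in> (\<lambda>(x, q). G x q) ` (cbox 0 1 \<times> cball 0 R) \<Longrightarrow> \<bar>y\<bar> \<le> M"
    by (metis compact_imp_bounded bounded_iff real_norm_def)
  have "\<bar>G x q\<bar> \<le> M" if "norm q \<le> R" for x q
  proof -
    obtain k where k: "\<And>i. k $ i \<in> \<int>" "x + k \<in> cbox 0 1" using torus_representative by blast
    have "\<bar>G (x + k) q\<bar> \<le> M" using k that by (intro M) force
    then show ?thesis using torus_periodicD[OF periodic k(1)] by simp
  qed
  then show ?thesis using that by blast
qed

text \<open>Compactness comes from the unit cell: one lattice vector moves \<open>x\<close> into it
  and \<open>y\<close> near it, and the momenta lie in a ball.\<close>

lemma uniformly_continuous:
  assumes "0 < e"
  obtains d where "0 < d"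
    "\<And>x q y r. \<lbrakk>norm q \<le> R; dist y x < d; dist r q < d\<rbrakk> \<Longrightarrow> \<bar>G y r - G x q\<bar> < e"
proof -
  obtain m where m: "\<And>x. x \<in> cbox (0::real^2) 1 \<Longrightarrow> norm x \<le> m"
    using bounded_cbox bounded_iff by metis
  \<comment> \<open>The margins of 1 leave room for the second point, since
    \<open>d' \<le> 1\<close>.\<close>
  have "uniformly_continuous_on (cball 0 (m + 1) \<times> cball 0 (R + 1)) (\<lambda>(x, q). G x q)"
    by (intro compact_uniformly_continuous continuous_on_subset[OF continuous] compact_Times) auto
  then obtain d where "0 < d" and d: "\<And>z w. \<lbrakk>z \<in> cball 0 (m + 1) \<times> cball 0 (R + 1);
      w \<in> cball 0 (m + 1) \<times> cball 0 (R + 1); dist w z < d\<rbrakk>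
      \<Longrightarrow> dist ((\<lambda>(x, q). G x q) w) ((\<lambda>(x, q). G x q) z) < e"
    unfolding uniformly_continuous_on_def using \<open>0 < e\<close> by metis
  define d' where "d' = min 1 (d/2)"
  have d': "0 < d'" "d' \<le> 1" "2 * d' \<le> d" using \<open>0 < d\<close> by (auto simp: d'_def)
  show ?thesis
  proof
    show "0 < d'" by fact
    fix x q y r :: "real^2" assume *: "norm q \<le> R" "dist y x < d'" "dist r q < d'"
    obtain k where k: "\<And>i. k $ i \<in> \<int>" "x + k \<in> cbox 0 1" using torus_representative by blast
    have "norm (y + k) \<le> norm (x + k) + dist y x"
      using norm_triangle_ineq[of "x + k" "y - x"] by (simp add: dist_norm add.commute)
    then have "norm (y + k) \<le> m + 1" using m[OF k(2)] * d' by linarith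
    moreover have "norm r \<le> norm q + dist r q"
      using norm_triangle_ineq[of q "r - q"] by (simp add: dist_norm)
    then have "norm r \<le> R + 1" using * d' by linarith
    moreover have "dist (y + k, r) (x + k, q) \<le> dist (y + k) (x + k) + dist r q"
      by (metis dist_Pair_Pair dist_real_def real_sqrt_abs sqrt_sum_squares_le_sum zero_le_dist)
    then have "dist (y + k, r) (x + k, q) < d" using * d' by (simp add: dist_norm)
    ultimately have "dist (G (y + k) r) (G (x + k) q) < e"
      using d[of "(x + k, q)" "(y + k, r)"] m[OF k(2)] * by force
    then show "\<bar>G y r - G x q\<bar> < e"
      using torus_periodicD[OF periodic k(1)] by (simp add: dist_real_def)
  qed
qed

text \<open>Momenta with \<open>G x q \<le> 0\<close> lie in a fixed ball, and there
  \<open>G\<close> is bounded.\<close>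

lemma bounded_below: obtains C where "0 \<le> C" "\<And>x q. - C \<le> G x q" "\<And>x. G x 0 \<le> C"
proof -
  obtain R where R: "0 \<le> R" "\<And>x q. G x q \<le> 0 \<Longrightarrow> norm q \<le> R" using coercive by blast
  obtain M where M: "\<And>x q. norm q \<le> R \<Longrightarrow> \<bar>G x q\<bar> \<le> M" using bounded_on_cball by blast
  have "0 \<le> M" using M[of 0] R by fastforce
  moreover have "- M \<le> G x q" for x q
    using R(2)[of x q] M[of q x] \<open>0 \<le> M\<close> by linarith
  moreover have "G x 0 \<le> M" for x using M[of 0 x] R by auto
  ultimately show ?thesis using that by blast
qed

section \<open>Lower bound and comparison for the constants\<close>

text \<open>\<open>F\<close> may have no test function at \<open>x\<close> itself, but it has one at
  some \<open>y\<close> close to \<open>x\<close>. Coercivity bounds the momentum there, so uniform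
  continuity transfers the inequality from \<open>y\<close> to \<open>x\<close>.\<close>

lemma subsolution_ge:
  assumes "continuous_on UNIV F" "viscosity_subsolution G c F" "\<And>q. m \<le> G x q"
  shows "m \<le> c"
proof (rule ccontr)
  assume "\<not> m \<le> c"
  obtain R where R: "\<And>x q. G x q \<le> c \<Longrightarrow> norm q \<le> R" using coercive by blast
  obtain d where "0 < d" and d:
    "\<And>x q y r. \<lbrakk>norm q \<le> R; dist y x < d; dist r q < d\<rbrakk> \<Longrightarrow> \<bar>G y r - G x q\<bar> < m - c"
    using uniformly_continuous[of "m - c" R] \<open>\<not> m \<le> c\<close> by (metis diff_gt_0_iff_gt not_le)
  obtain y q where y: "dist y x < d" "q \<in> superdiff F y"
    using superdiff_dense[OF assms(1) \<open>0 < d\<close>] by blast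
  have "G y q \<le> c" using assms(2) y(2) by (auto simp: viscosity_subsolution_iff)
  then have "\<bar>G x q - G y q\<bar> < m - c"
    using R y(1) \<open>0 < d\<close> by (intro d) (auto simp: dist_commute)
  then show False
    using \<open>G y q \<le> c\<close> assms(3)[of q] by linarith
qed

text \<open>Doubling of variables: at a maximum of
  \<open>F1 x - F2 y - a * (norm (x - y))\<^sup>2\<close> both functions are tested with the same
  momentum \<open>(2 * a) *\<^sub>R (x - y)\<close>. The subsolution inequality bounds it by
  \<open>R\<close>, so \<open>x\<close> and \<open>y\<close> are close and the two values of
  \<open>G\<close> differ by less than \<open>c2 - c1\<close>.\<close>

lemma supersolution_le_subsolution:
  assumes F1: "continuous_on UNIV F1" "torus_periodic F1" "viscosity_subsolution G c1 F1"
    and F2: "continuous_on UNIV F2" "torus_periodic F2" "viscosity_supersolution G c2 F2"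
  shows "c2 \<le> c1"
proof (rule ccontr)
  assume "\<not> c2 \<le> c1"
  then have "0 < c2 - c1" by simp
  obtain R where R: "0 \<le> R" "\<And>x q. G x q \<le> c1 \<Longrightarrow> norm q \<le> R" using coercive by blast
  obtain d where "0 < d" and d:
    "\<And>x q y r. \<lbrakk>norm q \<le> R; dist y x < d; dist r q < d\<rbrakk> \<Longrightarrow> \<bar>G y r - G x q\<bar> < c2 - c1"
    using uniformly_continuous[OF \<open>0 < c2 - c1\<close>] by metis
  obtain M1 where M1: "\<And>x. \<bar>F1 x\<bar> \<le> M1" using torus_periodic_bounded[OF F1(1,2)] by blast
  obtain M2 where M2: "\<And>x. \<bar>F2 x\<bar> \<le> M2" using torus_periodic_bounded[OF F2(1,2)] by blast
  have "0 \<le> M1" "0 \<le> M2" using M1 M2 abs_ge_zero order_trans by blast+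
  \<comment> \<open>The first condition keeps the maximiser off \<open>norm z = 1\<close>; the
    second turns \<open>2 * a * norm z \<le> R\<close> into \<open>norm z < d\<close>.\<close>
  obtain a where a: "2 * (M1 + M2) < a" "R / d < 2 * a" "0 < a"
  proof
    have "0 \<le> R / d" using R(1) \<open>0 < d\<close> by simp
    then show "2 * (M1 + M2) < 2 * (M1 + M2) + R / d + 1"
      "R / d < 2 * (2 * (M1 + M2) + R / d + 1)" "0 < 2 * (M1 + M2) + R / d + 1"
      using \<open>0 \<le> M1\<close> \<open>0 \<le> M2\<close> by argo+
  qed
  \<comment> \<open>In the variables \<open>x\<close> and \<open>z = x - y\<close> this is periodic
    in \<open>x\<close> for fixed \<open>z\<close>, so a maximum with \<open>x\<close> in the unit
    cell is a maximum over all \<open>x\<close>.\<close>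
  define \<Phi> where "\<Phi> x z = F1 x - F2 (x - z) - a * (norm z)\<^sup>2" for x z
  have "continuous_on (cbox 0 1 \<times> cball 0 1) (\<lambda>p. \<Phi> (fst p) (snd p))"
    unfolding \<Phi>_def
    by (intro continuous_intros continuous_on_compose2[OF F1(1)] continuous_on_compose2[OF F2(1)]) auto
  moreover have "compact (cbox (0::real^2) 1 \<times> cball (0::real^2) 1)"
    by (intro compact_Times) auto
  moreover have "(0, 0) \<in> cbox (0::real^2) 1 \<times> cball (0::real^2) 1" by (auto simp: mem_box_cart)
  ultimately obtain x z where xz: "x \<in> cbox 0 1" "z \<in> cball 0 1"
      and max0: "\<And>x' z'. \<lbrakk>x' \<in> cbox 0 1; z' \<in> cball 0 1\<rbrakk> \<Longrightarrow> \<Phi> x' z' \<le> \<Phi> x z"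
    using continuous_attains_sup[of "cbox (0::real^2) 1 \<times> cball (0::real^2) 1" "\<lambda>p. \<Phi> (fst p) (snd p)"]
    by (metis (no_types, lifting) SigmaE SigmaI empty_iff fst_conv snd_conv)
  have max: "\<Phi> x' z' \<le> \<Phi> x z" if "norm z' \<le> 1" for x' z'
  proof -
    obtain k where k: "\<And>i. k $ i \<in> \<int>" "x' + k \<in> cbox 0 1" using torus_representative by blast
    have "\<Phi> (x' + k) z' = \<Phi> x' z'"
      using torus_periodicD[OF F1(2) k(1), of x'] torus_periodicD[OF F2(2) k(1), of "x' - z'"]
      by (simp add: \<Phi>_def algebra_simps)
    then show ?thesis using max0[OF k(2), of z'] that by simp
  qed
  have "norm z \<noteq> 1"
    using max[of 0 x] M1[of x] M2[of x] M2[of "x - z"] a(1) \<open>0 \<le> M1\<close> by (auto simp: \<Phi>_def)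
  then have z1: "norm z < 1" using xz by simp
  define y where "y = x - z"
  have "\<forall>\<^sub>F w in nhds x. w \<in> ball y 1"
    using z1 by (intro eventually_nhds_in_open) (auto simp: y_def dist_norm)
  then have "\<forall>\<^sub>F w in nhds x. F1 w - a * (norm (w - y))\<^sup>2 \<le> F1 x - a * (norm (x - y))\<^sup>2"
  proof eventually_elim
    case (elim w)
    then show ?case using max[of "w - y" w] by (simp add: \<Phi>_def dist_norm norm_minus_commute y_def)
  qed
  then have "(2 * a) *\<^sub>R (x - y) \<in> superdiff F1 x"
    by (rule superdiffI[OF C1_with_gradient_quadratic refl])
  then have 1: "G x ((2 * a) *\<^sub>R z) \<le> c1"
    using F1(3) by (auto simp: viscosity_subsolution_iff y_def)
  have "\<forall>\<^sub>F w in nhds y. w \<in> ball x 1"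
    using z1 by (intro eventually_nhds_in_open) (auto simp: y_def dist_norm)
  then have "\<forall>\<^sub>F w in nhds y. - F2 w - a * (norm (w - x))\<^sup>2 \<le> - F2 y - a * (norm (y - x))\<^sup>2"
  proof eventually_elim
    case (elim w)
    then show ?case using max[of "x - w" x] by (simp add: \<Phi>_def dist_norm norm_minus_commute y_def)
  qed
  then have "(2 * a) *\<^sub>R (y - x) \<in> superdiff (\<lambda>w. - F2 w) y"
    by (rule superdiffI[OF C1_with_gradient_quadratic refl])
  then have "c2 \<le> G y (- ((2 * a) *\<^sub>R (y - x)))"
    using F2(3) unfolding viscosity_supersolution_iff by blast
  then have 2: "c2 \<le> G y ((2 * a) *\<^sub>R z)" by (simp add: y_def)
  have "norm ((2 * a) *\<^sub>R z) \<le> R" using R(2)[OF 1] .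
  then have "2 * a * norm z \<le> R" using a by simp
  also have "R < 2 * a * d" using a \<open>0 < d\<close> by (simp add: field_simps)
  finally have "norm z < d" using a by simp
  then have "\<bar>G y ((2 * a) *\<^sub>R z) - G x ((2 * a) *\<^sub>R z)\<bar> < c2 - c1"
    using R(2)[OF 1] \<open>0 < d\<close> by (intro d) (auto simp: y_def dist_norm)
  then show False using 1 2 by simp
qed

section \<open>Perron's method for the discounted equation\<close>

text \<open>The zero-order term enters by putting \<open>v\<close> itself into the Hamiltonian, so
  the notion for first-order equations also covers this one. The upper bound keeps the supremum
  finite, the lower one limits the slopes.\<close>

definition discounted_subsolutions :: "real \<Rightarrow> real \<Rightarrow> (real^2 \<Rightarrow> real) set" where
  "discounted_subsolutions \<delta> C = {v. continuous_on UNIV v \<and> (\<forall>x. \<bar>v x\<bar> \<le> C / \<delta>) \<and>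
     viscosity_subsolution (\<lambda>x q. \<delta> * v x + G x q) 0 v}"

text \<open>Perron's method. The competitors are not required to be periodic: the family is invariant
  under translation by \<open>\<int>\<^sup>2\<close>, hence so is its supremum.\<close>

lemma discounted_solution:
  assumes "0 < \<delta>" and C: "0 \<le> C" "\<And>x q. - C \<le> G x q" "\<And>x. G x 0 \<le> C"
    and L: "0 \<le> L" "\<And>x q. G x q \<le> C \<Longrightarrow> norm q \<le> L"
  obtains F where "torus_periodic F" "\<And>x. \<bar>\<delta> * F x\<bar> \<le> C"
    "\<And>x y. \<bar>F y - F x\<bar> \<le> L * norm (y - x)"
    "viscosity_subsolution (\<lambda>x q. \<delta> * F x + G x q) 0 F"
    "viscosity_supersolution (\<lambda>x q. \<delta> * F x + G x q) 0 F"
proof -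
  define S where "S = discounted_subsolutions \<delta> C"
  have S_iff: "v \<in> S \<longleftrightarrow> continuous_on UNIV v \<and> (\<forall>x. \<bar>v x\<bar> \<le> C / \<delta>) \<and>
     (\<forall>x. \<forall>q\<in>superdiff v x. \<delta> * v x + G x q \<le> 0)" for v
    unfolding S_def discounted_subsolutions_def viscosity_subsolution_iff by blast
  have vcont: "continuous_on UNIV v" and vbd: "\<bar>v x\<bar> \<le> C / \<delta>"
    and vsub: "q \<in> superdiff v x \<Longrightarrow> \<delta> * v x + G x q \<le> 0" if "v \<in> S" for v x q
    using that unfolding S_iff by blast+
  \<comment> \<open>A subsolution because \<open>G x 0 \<le> C\<close>; it makes \<open>S\<close>
    nonempty.\<close>
  have const: "(\<lambda>x. - C / \<delta>) \<in> S"
    unfolding S_iff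
  proof (intro conjI allI ballI)
    fix x q assume "q \<in> superdiff (\<lambda>x. - C / \<delta>) x"
    then have "q = 0"
      by (rule superdiff_eq_gradient[OF C1_with_gradient_const]) auto
    then show "\<delta> * (- C / \<delta>) + G x q \<le> 0" using C(3)[of x] \<open>0 < \<delta>\<close> by simp
  qed (use C(1) \<open>0 < \<delta>\<close> in auto)
  define F where "F x = (SUP v\<in>S. v x)" for x
  have bdd: "bdd_above ((\<lambda>v. v x) ` S)" for x
    using vbd by (intro bdd_aboveI[of _ "C / \<delta>"]) (auto simp: abs_le_iff)
  have ub: "v x \<le> F x" if "v \<in> S" for v x
    unfolding F_def using that bdd by (intro cSUP_upper) auto
  have lub: "F x \<le> B" if "\<And>v. v \<in> S \<Longrightarrow> v x \<le> B" for x B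
    unfolding F_def using const that by (intro cSUP_least) auto
  have approx: "\<exists>v\<in>S. F x - e < v x" if "0 < e" for x e
    using that lub[of x "F x - e"] by (metis diff_less_eq less_add_same_cancel1 linorder_not_less)
  have Fbd: "\<bar>F x\<bar> \<le> C / \<delta>" for x
    using ub[OF const, of x] lub[of x "C / \<delta>"] vbd by (auto simp: abs_le_iff)
  have per1: "F (x + k) \<le> F x" if k: "\<And>i. k $ i \<in> \<int>" for x k
  proof (rule lub)
    fix v assume v: "v \<in> S"
    have "(\<lambda>y. v (y + k)) \<in> S"
      unfolding S_iff
    proof (intro conjI allI ballI)
      show "continuous_on UNIV (\<lambda>y. v (y + k))"
        using vcont[OF v] by (rule continuous_on_compose2) (auto intro: continuous_intros)
      fix y q assume "q \<in> superdiff (\<lambda>y. v (y + k)) y"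
      then have "\<delta> * v (y + k) + G (y + k) q \<le> 0"
        using vsub[OF v superdiff_translate] by blast
      then show "\<delta> * v (y + k) + G y q \<le> 0"
        using torus_periodicD[OF periodic k] by simp
    qed (use vbd[OF v] in auto)
    from ub[OF this, of x] show "v (x + k) \<le> F x" .
  qed
  have per: "torus_periodic F"
    unfolding torus_periodic_def
  proof (intro allI impI antisym)
    fix x k :: "real^2" assume k: "\<forall>i. k $ i \<in> \<int>"
    show "F (x + k) \<le> F x" using per1 k by blast
    show "F x \<le> F (x + k)" using per1[of "- k" "x + k"] k by simp
  qed
  \<comment> \<open>The lower bound on \<open>v\<close> turns the discounted inequality into
    \<open>G z q \<le> C\<close>. All competitors thus share the constant \<open>L\<close>, which is
    independent of \<open>\<delta>\<close>, and the supremum inherits it.\<close>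
  have vLip: "v y - v x \<le> L * norm (y - x)" if "v \<in> S" for v x y
  proof (rule superdiff_bounded_imp_Lipschitz[OF vcont[OF that] vbd[OF that] L(1)])
    fix z q assume "q \<in> superdiff v z"
    then have "\<delta> * v z + G z q \<le> 0" by (rule vsub[OF that])
    moreover have "\<delta> * (- (C / \<delta>)) \<le> \<delta> * v z"
      using vbd[OF that, of z] \<open>0 < \<delta>\<close> by (intro mult_left_mono) auto
    ultimately show "norm q \<le> L"
      using \<open>0 < \<delta>\<close> by (intro L(2)[of z]) simp
  qed
  have FLip: "F y - F x \<le> L * norm (y - x)" for x y
    using lub[of y "F x + L * norm (y - x)"] vLip[of _ y x] ub[of _ x] by fastforce
  have Lip: "\<bar>F y - F x\<bar> \<le> L * norm (y - x)" for x y
    using FLip[of y x] FLip[of x y] by (simp add: norm_minus_commute abs_le_iff)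
  have Fcont: "continuous_on UNIV F"
    by (intro lipschitz_on_continuous_on[of L] lipschitz_onI) (use Lip L(1) in \<open>auto simp: dist_norm norm_minus_commute\<close>)
  have Fsub: "\<delta> * F x + G x q \<le> 0" if q: "q \<in> superdiff F x" for x q
  proof (rule ccontr)
    define e where "e = (\<delta> * F x + G x q) / 2"
    assume "\<not> \<delta> * F x + G x q \<le> 0"
    then have "0 < e" by (simp add: e_def)
    obtain d where "0 < d" and d:
      "\<And>y r. \<lbrakk>dist y x < d; dist r q < d\<rbrakk> \<Longrightarrow> \<bar>G y r - G x q\<bar> < e"
      using uniformly_continuous[OF \<open>0 < e\<close>, of "norm q"] by (metis order_refl)
    \<comment> \<open>The discount term and \<open>G\<close> may each lose at most \<open>e\<close>,
      together no more than the excess \<open>2 * e\<close>.\<close>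
    define e' where "e' = min d (e / \<delta>)"
    have e': "0 < e'" "e' \<le> d" "\<delta> * e' \<le> e"
      using \<open>0 < d\<close> \<open>0 < e\<close> \<open>0 < \<delta>\<close> by (auto simp: e'_def min_def field_simps)
    obtain d' where "0 < d'" and d': "\<And>v. \<lbrakk>continuous_on UNIV v; \<And>y. dist y x < e' \<Longrightarrow> v y \<le> F y + d';
        F x - d' \<le> v x\<rbrakk> \<Longrightarrow> \<exists>y. \<exists>r\<in>superdiff v y. dist y x < e' \<and> \<bar>v y - F x\<bar> < e' \<and> dist r q < e'"
      using superdiff_stable[OF Fcont q e'(1)] by metis
    obtain v where v: "v \<in> S" "F x - d' < v x" using approx[OF \<open>0 < d'\<close>] by blast
    have "v y \<le> F y + d'" for y using ub[OF v(1), of y] \<open>0 < d'\<close> by simp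
    then obtain y r where yr: "r \<in> superdiff v y" "dist y x < e'" "\<bar>v y - F x\<bar> < e'" "dist r q < e'"
      using d'[OF vcont[OF v(1)]] v(2) by (meson less_imp_le)
    have "\<delta> * (F x - e') \<le> \<delta> * v y" using yr(3) \<open>0 < \<delta>\<close> by (intro mult_left_mono) auto
    then have "\<delta> * F x - e \<le> \<delta> * v y" using e'(3) by (simp add: right_diff_distrib)
    moreover have "\<bar>G y r - G x q\<bar> < e" using yr e' by (intro d) auto
    then have "G x q - e < G y r" by (simp add: abs_less_iff)
    moreover have "\<delta> * v y + G y r \<le> 0" using vsub[OF v(1) yr(1)] .
    ultimately show False unfolding e_def by argo
  qed
  \<comment> \<open>If the inequality failed at \<open>x0\<close>, raising \<open>F\<close> to a
    lifted test function near \<open>x0\<close> would produce a competitor larger than the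
    supremum.\<close>
  have Fsuper: "0 \<le> \<delta> * F x0 + G x0 (- q)" if q: "q \<in> superdiff (\<lambda>y. - F y) x0" for x0 q
  proof (rule ccontr)
    assume neg: "\<not> 0 \<le> \<delta> * F x0 + G x0 (- q)"
    obtain \<phi> g where \<phi>: "C1_with_gradient \<phi> g" "g x0 = q"
      "\<forall>\<^sub>F y in nhds x0. - F y - \<phi> y \<le> - F x0 - \<phi> x0"
      using q unfolding superdiff_def by blast
    \<comment> \<open>\<open>\<psi>\<close> touches \<open>F\<close> from below at
      \<open>x0\<close>; the square pushes it strictly below \<open>F\<close> away from
      \<open>x0\<close>, which leaves room for gluing.\<close>
    define \<psi> where "\<psi> y = (F x0 + \<phi> x0) - (\<phi> y + 1 * (norm (y - x0))\<^sup>2)" for y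
    define h where "h y = 0 - (g y + (2 * 1) *\<^sub>R (y - x0))" for y
    have \<psi>: "C1_with_gradient \<psi> h"
      unfolding \<psi>_def h_def
      by (intro C1_with_gradient_diff C1_with_gradient_add \<phi>(1) C1_with_gradient_quadratic C1_with_gradient_const)
    have \<psi>0: "\<psi> x0 = F x0" "h x0 = - q" using \<phi>(2) by (auto simp: \<psi>_def h_def)
    define K where "K y = \<delta> * \<psi> y + G y (h y)" for y
    define e1 where "e1 = - K x0 / 2"
    have "0 < e1" using neg \<psi>0 by (simp add: e1_def K_def)
    \<comment> \<open>Failure of the inequality and \<open>- C \<le> G\<close> force
      \<open>F x0 < C / \<delta>\<close>, so the raised function can respect the upper
      bound.\<close>
    define e2 where "e2 = (C / \<delta> - F x0) / 2"
    have "0 < e2"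
    proof -
      have "\<delta> * F x0 < C" using neg C(2)[of x0 "- q"] by simp
      then show ?thesis using \<open>0 < \<delta>\<close> by (simp add: e2_def field_simps)
    qed
    have "continuous_on UNIV h" using \<psi> by (simp add: C1_with_gradient_def)
    then have "continuous_on UNIV (\<lambda>y. (\<lambda>(x, q). G x q) (y, h y))"
      by (intro continuous_on_compose2[OF continuous] continuous_intros) auto
    then have "continuous_on UNIV K"
      unfolding K_def by (intro continuous_intros C1_with_gradient_continuous_on[OF \<psi>]) auto
    then have "\<forall>\<^sub>F y in nhds x0. dist (K y) (K x0) < e1"
      using \<open>0 < e1\<close> by (intro isCont_eventually_dist) (auto simp: continuous_on_eq_continuous_at)
    moreover have "\<forall>\<^sub>F y in nhds x0. dist (\<psi> y) (\<psi> x0) < e2"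
      using \<open>0 < e2\<close> by (intro isCont_eventually_dist C1_with_gradient_isCont[OF \<psi>]) auto
    ultimately have "\<forall>\<^sub>F y in nhds x0. dist (K y) (K x0) < e1 \<and> dist (\<psi> y) (\<psi> x0) < e2 \<and>
        - F y - \<phi> y \<le> - F x0 - \<phi> x0"
      using \<phi>(3) by eventually_elim simp
    then obtain r where "0 < r" and r: "\<And>y. dist y x0 < r \<Longrightarrow> dist (K y) (K x0) < e1 \<and>
        dist (\<psi> y) (\<psi> x0) < e2 \<and> - F y - \<phi> y \<le> - F x0 - \<phi> x0"
      unfolding eventually_nhds_metric by blast
    \<comment> \<open>Three demands: the raised piece stays a subsolution
      (\<open>e1 / \<delta>\<close>), stays below \<open>C / \<delta>\<close> (\<open>e2\<close>),
      and does not exceed \<open>F\<close> beyond distance \<open>r / 2\<close>, where the gap is at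
      least \<open>r\<^sup>2 / 4\<close>.\<close>
    define \<eta> where "\<eta> = min (min (e1 / \<delta>) e2) (r\<^sup>2 / 8)"
    have \<eta>: "0 < \<eta>" "\<eta> \<le> e2" "\<eta> \<le> r\<^sup>2 / 8"
    proof -
      show "0 < \<eta>" using \<open>0 < e1\<close> \<open>0 < e2\<close> \<open>0 < r\<close> \<open>0 < \<delta>\<close> by (simp add: \<eta>_def)
    qed (simp_all only: \<eta>_def min.cobounded2 min.coboundedI1)
    have "\<eta> \<le> e1 / \<delta>" unfolding \<eta>_def by (intro min.coboundedI1) simp
    then have \<delta>\<eta>: "\<delta> * \<eta> \<le> e1" using \<open>0 < \<delta>\<close> by (simp add: field_simps)
    have K_neg: "K y < - e1" if "dist y x0 < r" for y
      using r[OF that] by (simp add: e1_def dist_real_def abs_less_iff)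
    have \<psi>_less: "\<psi> y + \<eta> < C / \<delta>" if "dist y x0 < r" for y
    proof -
      have "\<psi> y - F x0 < e2" using r[OF that] \<psi>0 by (simp add: dist_real_def abs_less_iff)
      moreover have "2 * e2 = C / \<delta> - F x0" by (simp add: e2_def)
      ultimately show ?thesis using \<eta>(2) by linarith
    qed
    have \<psi>_below: "\<psi> y + (norm (y - x0))\<^sup>2 \<le> F y" if "dist y x0 < r" for y
      using r[OF that] by (simp add: \<psi>_def)
    define w where "w y = (if dist y x0 < r then max (F y) (\<psi> y + \<eta>) else F y)" for y
    have Fw: "F y \<le> w y" for y by (simp add: w_def)
    have w_eq: "w y = F y" if "r / 2 < dist y x0" for y
    proof (cases "dist y x0 < r")
      case True
      have "(r / 2)\<^sup>2 \<le> (norm (y - x0))\<^sup>2"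
        using that \<open>0 < r\<close> by (intro power_mono) (auto simp: dist_norm)
      then have "r\<^sup>2 / 4 \<le> (norm (y - x0))\<^sup>2" by (simp add: power_divide)
      moreover have "0 < r\<^sup>2" using \<open>0 < r\<close> by simp
      ultimately have "\<psi> y + \<eta> \<le> F y" using \<psi>_below[OF True] \<eta>(3) by linarith
      then show ?thesis by (simp add: w_def)
    qed (simp add: w_def)
    have "continuous_on (ball x0 r \<union> - cball x0 (r / 2)) w"
    proof (rule continuous_on_open_Un)
      show "continuous_on (ball x0 r) w"
      proof (rule continuous_on_eq)
        show "continuous_on (ball x0 r) (\<lambda>y. max (F y) (\<psi> y + \<eta>))"
          by (intro continuous_intros C1_with_gradient_continuous_on[OF \<psi>] continuous_on_subset[OF Fcont]) auto
      qed (simp add: w_def dist_commute)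
      show "continuous_on (- cball x0 (r / 2)) w"
        by (rule continuous_on_eq[OF continuous_on_subset[OF Fcont]]) (auto simp: w_eq dist_commute)
    qed auto
    moreover have "ball x0 r \<union> - cball x0 (r / 2) = UNIV" using \<open>0 < r\<close> by auto
    ultimately have wcont: "continuous_on UNIV w" by simp
    have "w \<in> S"
      unfolding S_iff
    proof (intro conjI allI ballI)
      fix y
      have "w y \<le> C / \<delta>"
        using Fbd[of y] \<psi>_less[of y] by (auto simp: w_def abs_le_iff)
      moreover have "- (C / \<delta>) \<le> w y" using Fbd[of y] Fw[of y] by (simp add: abs_le_iff)
      ultimately show "\<bar>w y\<bar> \<le> C / \<delta>" by (simp add: abs_le_iff)
      fix s assume s: "s \<in> superdiff w y"
      show "\<delta> * w y + G y s \<le> 0"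
      \<comment> \<open>Where \<open>w\<close> and \<open>F\<close> agree, test functions for
        \<open>w\<close> also test \<open>F\<close>. Elsewhere \<open>\<psi> + \<eta>\<close>
        touches \<open>w\<close> from below, so \<open>s\<close> must be its gradient.\<close>
      proof (cases "w y = F y")
        case True
        have "s \<in> superdiff F y" by (rule superdiff_antimono[OF s]) (use Fw True in auto)
        then show ?thesis using Fsub True by simp
      next
        case False
        then have y: "dist y x0 < r" "w y = \<psi> y + \<eta>" by (auto simp: w_def max_def split: if_splits)
        have "\<forall>\<^sub>F z in nhds y. z \<in> ball x0 r"
          using y(1) by (intro eventually_nhds_in_open) (auto simp: dist_commute)
        then have "\<forall>\<^sub>F z in nhds y. \<psi> z + \<eta> \<le> w z"
          by eventually_elim (simp add: w_def dist_commute)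
        then have "s = h y + 0"
          using superdiff_eq_gradient[OF C1_with_gradient_add[OF \<psi> C1_with_gradient_const[of \<eta>]] s] y(2) by simp
        then have "\<delta> * w y + G y s = K y + \<delta> * \<eta>" using y(2) by (simp add: K_def algebra_simps)
        then show ?thesis using K_neg[OF y(1)] \<delta>\<eta> by simp
      qed
    qed (use wcont in auto)
    from ub[OF this, of x0] have "\<psi> x0 + \<eta> \<le> F x0" using \<open>0 < r\<close> by (simp add: w_def)
    then show False using \<psi>0 \<eta>(1) by simp
  qed
  show ?thesis
  proof
    show "\<bar>\<delta> * F x\<bar> \<le> C" for x
      using Fbd[of x] \<open>0 < \<delta>\<close> by (simp add: abs_mult field_simps)
    show "viscosity_subsolution (\<lambda>x q. \<delta> * F x + G x q) 0 F"
      using Fsub by (auto simp: viscosity_subsolution_iff)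
    show "viscosity_supersolution (\<lambda>x q. \<delta> * F x + G x q) 0 F"
      using Fsuper by (auto simp: viscosity_supersolution_iff)
  qed (use per Lip in auto)
qed

section \<open>Vanishing discount and the ergodic constant\<close>

text \<open>The bounds on \<open>\<delta> * F x\<close> and on the Lipschitz constant do not depend
  on \<open>\<delta>\<close>. Along a subsequence \<open>\<delta> * F 0\<close> tends to a number
  \<open>c\<close> and \<open>F x - F 0\<close> converges uniformly; the discount term becomes
  constant, whence the level \<open>- c\<close>.\<close>

lemma cell_problem_solution:
  obtains c F where "torus_periodic F" "viscosity_solution G c F"
proof -
  obtain C where C: "0 \<le> C" "\<And>x q. - C \<le> G x q" "\<And>x. G x 0 \<le> C" by (rule bounded_below) (rule that)
  obtain L where L: "0 \<le> L" "\<And>x q. G x q \<le> C \<Longrightarrow> norm q \<le> L" using coercive by blast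
  define \<delta> where "\<delta> n = inverse (real (Suc n))" for n
  have \<delta>: "0 < \<delta> n" for n by (simp add: \<delta>_def)
  have \<delta>_lim: "\<delta> \<longlonglongrightarrow> 0" unfolding \<delta>_def by (rule LIMSEQ_inverse_real_of_nat)
  have "\<exists>F. torus_periodic F \<and> (\<forall>x. \<bar>\<delta> n * F x\<bar> \<le> C) \<and> (\<forall>x y. \<bar>F y - F x\<bar> \<le> L * norm (y - x)) \<and>
    viscosity_subsolution (\<lambda>x q. \<delta> n * F x + G x q) 0 F \<and>
    viscosity_supersolution (\<lambda>x q. \<delta> n * F x + G x q) 0 F" for n
    by (rule discounted_solution[OF \<delta> C L]) blast+
  then have "\<exists>F. \<forall>n. torus_periodic (F n) \<and> (\<forall>x. \<bar>\<delta> n * F n x\<bar> \<le> C) \<and>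
    (\<forall>x y. \<bar>F n y - F n x\<bar> \<le> L * norm (y - x)) \<and>
    viscosity_subsolution (\<lambda>x q. \<delta> n * F n x + G x q) 0 (F n) \<and>
    viscosity_supersolution (\<lambda>x q. \<delta> n * F n x + G x q) 0 (F n)"
    by (intro choice allI)
  then obtain F where F: "\<And>n. torus_periodic (F n)" "\<And>n x. \<bar>\<delta> n * F n x\<bar> \<le> C"
    "\<And>n x y. \<bar>F n y - F n x\<bar> \<le> L * norm (y - x)"
    "\<And>n. viscosity_subsolution (\<lambda>x q. \<delta> n * F n x + G x q) 0 (F n)"
    "\<And>n. viscosity_supersolution (\<lambda>x q. \<delta> n * F n x + G x q) 0 (F n)"
    by blast
  define a where "a n = \<delta> n * F n 0" for n
  have "a n \<in> cball 0 C" for n using F(2) by (simp add: a_def)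
  then obtain c s where s: "strict_mono (s :: nat \<Rightarrow> nat)" "(a \<circ> s) \<longlonglongrightarrow> c"
    using compact_cball[of "0::real" C] seq_compactE[of "cball 0 C" a] unfolding compact_eq_seq_compact_metric
    by blast
  define v where "v n x = F (s n) x - F (s n) 0" for n x
  obtain m where m: "\<And>x. x \<in> cbox (0::real^2) 1 \<Longrightarrow> norm x \<le> m"
    using bounded_cbox bounded_iff by metis
  have v_per: "torus_periodic (v n)" for n
    using F(1) unfolding v_def torus_periodic_def by metis
  have v_Lip: "\<bar>v n y - v n x\<bar> \<le> L * norm (y - x)" for n x y
    using F(3) by (simp add: v_def)
  have v_cont: "continuous_on UNIV (v n)" for n
    by (intro lipschitz_on_continuous_on[of L] lipschitz_onI) (use v_Lip L(1) in \<open>auto simp: dist_norm norm_minus_commute\<close>)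
  have v_bd0: "norm (v n x) \<le> L * m" if "x \<in> cbox 0 1" for n x
  proof -
    have "\<bar>v n x - v n 0\<bar> \<le> L * norm (x - 0)" by (rule v_Lip)
    also have "\<dots> \<le> L * m" using m[OF that] L(1) by (simp add: mult_left_mono)
    finally show ?thesis by (simp add: v_def)
  qed
  have v_bd: "\<bar>v n x\<bar> \<le> L * m" for n x
  proof -
    obtain k where "\<And>i. k $ i \<in> \<int>" "x + k \<in> cbox 0 1" using torus_representative by blast
    then show ?thesis using torus_periodicD[OF v_per, of k n x] v_bd0[of "x + k" n] by simp
  qed
  have equi: "\<exists>d. 0 < d \<and> (\<forall>n y. y \<in> cbox 0 1 \<and> norm (x - y) < d \<longrightarrow> norm (v n x - v n y) < e)"
    if "x \<in> cbox 0 1" "0 < e" for x and e :: real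
  proof (intro exI[of _ "e / (L + 1)"] conjI allI impI)
    show "0 < e / (L + 1)" using \<open>0 < e\<close> L(1) by simp
    fix n y assume "y \<in> cbox 0 1 \<and> norm (x - y) < e / (L + 1)"
    then have "(L + 1) * norm (x - y) < e" using L(1) by (simp add: field_simps)
    then have "L * norm (x - y) < e"
      using norm_ge_zero[of "x - y"] unfolding distrib_right by linarith
    then show "norm (v n x - v n y) < e" using v_Lip[of n x y] by simp
  qed
  obtain u0 t where t: "strict_mono (t :: nat \<Rightarrow> nat)"
    and u0: "\<And>e. 0 < e \<Longrightarrow> \<exists>N. \<forall>n x. n \<ge> N \<and> x \<in> cbox 0 1 \<longrightarrow> norm (v (t n) x - u0 x) < e"
    by (rule Arzela_Ascoli[OF compact_cbox v_bd0 equi]) (assumption | blast)+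
  \<comment> \<open>Arzela-Ascoli gives uniform convergence on the cell; representatives in the cell
    carry it to the whole plane.\<close>
  have "\<forall>x. \<exists>x'\<in>cbox 0 1. \<forall>n. v n x = v n x'"
  proof
    fix x :: "real^2"
    obtain k where "\<And>i. k $ i \<in> \<int>" "x + k \<in> cbox 0 1" using torus_representative by blast
    then show "\<exists>x'\<in>cbox 0 1. \<forall>n. v n x = v n x'"
      using torus_periodicD[OF v_per, of k _ x] by (intro bexI[of _ "x + k"]) auto
  qed
  then have "\<exists>\<rho>. \<forall>x. \<rho> x \<in> cbox 0 1 \<and> (\<forall>n. v n x = v n (\<rho> x))"
    by (intro choice) blast
  then obtain \<rho> where \<rho>: "\<And>x. \<rho> x \<in> cbox 0 1" "\<And>n x. v n x = v n (\<rho> x)" by blast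
  define u where "u x = u0 (\<rho> x)" for x
  have unif: "uniform_limit UNIV (\<lambda>n. v (t n)) u sequentially"
    unfolding uniform_limit_sequentially_iff
  proof (intro allI impI)
    fix e :: real assume "0 < e"
    obtain N where N: "\<And>n x. N \<le> n \<Longrightarrow> x \<in> cbox 0 1 \<Longrightarrow> norm (v (t n) x - u0 x) < e"
      using u0[OF \<open>0 < e\<close>] by blast
    have "dist (v (t n) x) (u x) < e" if "N \<le> n" for n x
      using N[OF that \<rho>(1)[of x]] unfolding u_def dist_norm \<rho>(2)[of "t n" x] .
    then show "\<exists>N. \<forall>n\<ge>N. \<forall>x\<in>UNIV. dist (v (t n) x) (u x) < e" by blast
  qed
  have "torus_periodic u"
    unfolding torus_periodic_def
  proof (intro allI impI)
    fix x k :: "real^2" assume k: "\<forall>i. k $ i \<in> \<int>"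
    have "(\<lambda>n. v (t n) (x + k)) \<longlonglongrightarrow> u (x + k)" "(\<lambda>n. v (t n) x) \<longlonglongrightarrow> u x"
      using tendsto_uniform_limitI[OF unif] by auto
    moreover have "v (t n) (x + k) = v (t n) x" for n
      using torus_periodicD[OF v_per] k by blast
    ultimately show "u (x + k) = u x" using LIMSEQ_unique by simp
  qed
  moreover have "viscosity_solution G (- c) u"
    unfolding viscosity_solution_def
  proof (intro conjI)
    show "continuous_on UNIV u"
      using uniform_limit_theorem[OF _ unif] v_cont by simp
    have st: "strict_mono (s \<circ> t)" using s(1) t strict_mono_o by blast
    have A: "(\<lambda>n. a (s (t n))) \<longlonglongrightarrow> c"
      using LIMSEQ_subseq_LIMSEQ[OF s(2) t] by (simp add: o_def)
    have D: "(\<lambda>n. \<delta> (s (t n)) * (L * m)) \<longlonglongrightarrow> 0"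
      using LIMSEQ_subseq_LIMSEQ[OF \<delta>_lim st] by (auto simp: o_def intro: tendsto_mult_left_zero)
    \<comment> \<open>The discount term equals \<open>a (s n)\<close> up to an error of at most
      \<open>\<delta> (s n) * (L * m)\<close>. Moving this vanishing error into the level gives
      inequalities for \<open>G\<close> alone.\<close>
    have id: "\<delta> (s n) * F (s n) x = a (s n) + \<delta> (s n) * v n x" for n x
      by (simp add: a_def v_def algebra_simps)
    have small: "\<bar>\<delta> (s n) * v n x\<bar> \<le> \<delta> (s n) * (L * m)" for n x
      using v_bd[of n x] \<delta>[of "s n"] by (simp add: abs_mult)
    have sd: "superdiff (v n) x = superdiff (F (s n)) x" for n x
      unfolding v_def by (rule superdiff_minus_const)
    have sd': "superdiff (\<lambda>y. - v n y) x = superdiff (\<lambda>y. - F (s n) y) x" for n x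
      using superdiff_minus_const[of "\<lambda>y. - F (s n) y" "- F (s n) 0"] by (simp add: v_def)
    show "viscosity_subsolution G (- c) u"
    proof (rule viscosity_subsolution_limit[OF continuous _ unif])
      show "(\<lambda>n. - a (s (t n)) + \<delta> (s (t n)) * (L * m)) \<longlonglongrightarrow> - c"
        using tendsto_add[OF tendsto_minus[OF A] D] by simp
      fix n
      have "G x q \<le> - a (s (t n)) + \<delta> (s (t n)) * (L * m)" if "q \<in> superdiff (v (t n)) x" for x q
      proof -
        have "\<delta> (s (t n)) * F (s (t n)) x + G x q \<le> 0"
          using F(4)[of "s (t n)"] that unfolding sd viscosity_subsolution_iff by blast
        then show ?thesis using small[of "t n" x] unfolding id by linarith
      qed
      then show "viscosity_subsolution G (- a (s (t n)) + \<delta> (s (t n)) * (L * m)) (v (t n))"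
        unfolding viscosity_subsolution_iff by blast
    qed (rule v_cont)
    show "viscosity_supersolution G (- c) u"
    proof (rule viscosity_supersolution_limit[OF continuous _ unif])
      show "(\<lambda>n. - a (s (t n)) - \<delta> (s (t n)) * (L * m)) \<longlonglongrightarrow> - c"
        using tendsto_diff[OF tendsto_minus[OF A] D] by simp
      fix n
      have "- a (s (t n)) - \<delta> (s (t n)) * (L * m) \<le> G x (- q)"
        if "q \<in> superdiff (\<lambda>y. - v (t n) y) x" for x q
      proof -
        have "0 \<le> \<delta> (s (t n)) * F (s (t n)) x + G x (- q)"
          using F(5)[of "s (t n)"] that unfolding sd' viscosity_supersolution_iff by blast
        then show ?thesis using small[of "t n" x] unfolding id by linarith
      qed
      then show "viscosity_supersolution G (- a (s (t n)) - \<delta> (s (t n)) * (L * m)) (v (t n))"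
        unfolding viscosity_supersolution_iff by blast
    qed (rule v_cont)
  qed
  ultimately show ?thesis using that by blast
qed

text \<open>Uniqueness is comparison in both directions. This gives the \<open>THE\<close> in
  \<open>effective_hamiltonian\<close> its meaning.\<close>

lemma ex1_cell_problem: "\<exists>!c. \<exists>F. torus_periodic F \<and> viscosity_solution G c F"
proof -
  obtain c F where "torus_periodic F" "viscosity_solution G c F" by (rule cell_problem_solution) (rule that)
  moreover have "c1 \<le> c2" if "torus_periodic F1" "viscosity_solution G c1 F1"
      "torus_periodic F2" "viscosity_solution G c2 F2" for c1 c2 F1 F2
    using supersolution_le_subsolution[of F2 c2 F1 c1] that unfolding viscosity_solution_def by blast
  ultimately show ?thesis by (intro ex1I[of _ c]) (auto intro!: antisym)
qed

end

subsection \<open>The cellular flow\<close>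

lemma norm_vec2_squared: "(norm (x::real^2))\<^sup>2 = (x $ 1)\<^sup>2 + (x $ 2)\<^sup>2"
  unfolding power2_norm_eq_inner by (simp add: inner_vec_def sum_2 power2_eq_square)

lemma cellular_flow_eq:
  "cellular_flow x = (- 2 * pi * sin (2 * pi * x $ 1) * cos (2 * pi * x $ 2)) *\<^sub>R axis 1 1
     + (2 * pi * cos (2 * pi * x $ 1) * sin (2 * pi * x $ 2)) *\<^sub>R axis 2 1"
proof -
  have nth: "((\<lambda>x::real^2. x $ i) has_derivative (\<lambda>h. h $ i)) (at x)" for i
    by (rule bounded_linear_imp_has_derivative[OF bounded_linear_vec_nth])
  have "(cellular_stream has_derivative (\<lambda>h. 2 * pi * cos (2 * pi * x $ 1) * sin (2 * pi * x $ 2) * h $ 1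
      + 2 * pi * sin (2 * pi * x $ 1) * cos (2 * pi * x $ 2) * h $ 2)) (at x)"
    unfolding cellular_stream_def
    by (auto intro!: derivative_eq_intros nth simp: algebra_simps)
  then have "frechet_derivative cellular_stream (at x) =
    (\<lambda>h. 2 * pi * cos (2 * pi * x $ 1) * sin (2 * pi * x $ 2) * h $ 1
      + 2 * pi * sin (2 * pi * x $ 1) * cos (2 * pi * x $ 2) * h $ 2)"
    by (rule frechet_derivative_at[symmetric])
  then show ?thesis
    unfolding cellular_flow_def stream_flow_def partial_deriv_def
    by (simp add: vec_eq_iff forall_2 axis_def)
qed

lemma cellular_flow_continuous: "continuous_on UNIV cellular_flow"
  unfolding cellular_flow_eq[abs_def] by (intro continuous_intros)

lemma cellular_flow_periodic: "torus_periodic cellular_flow"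
  unfolding torus_periodic_def
proof (intro allI impI)
  fix x k :: "real^2" assume k: "\<forall>i. k $ i \<in> \<int>"
  have "sin (2 * pi * (x $ i + k $ i)) = sin (2 * pi * x $ i)
      \<and> cos (2 * pi * (x $ i + k $ i)) = cos (2 * pi * x $ i)" for i
  proof -
    obtain n where "k $ i = of_int n" using k Ints_cases by blast
    then have "2 * pi * (x $ i + k $ i) = 2 * pi * x $ i + of_int n * (2 * pi)"
      by (simp add: algebra_simps)
    then show ?thesis using sin.plus_of_int[of "2 * pi * x $ i" n]
        cos.plus_of_int[of "2 * pi * x $ i" n] by simp
  qed
  then show "cellular_flow (x + k) = cellular_flow x"
    unfolding cellular_flow_eq by simp
qed

section \<open>The logarithmic profile\<close>

text \<open>A profile that climbs from \<open>t\<close> to \<open>t + 1\<close> with slope proportional to \<open>1 / (\<epsilon> + \<bar>sin 2\<pi>t\<bar>)\<close>: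
  it crosses the separatrices \<open>sin 2\<pi>t = 0\<close> steeply but spreads each crossing evenly over all
  scales between \<open>\<epsilon>\<close> and \<open>1\<close>, so that \<open>\<bar>sin 2\<pi>t\<bar>\<close> times the slope is \<open>O(1 / ln (1/\<epsilon>))\<close>.\<close>

lemma log_profile:
  assumes "0 < \<epsilon>" "\<epsilon> < 1"
  obtains \<psi> k :: "real \<Rightarrow> real" where
    "\<And>t. (\<psi> has_real_derivative k t) (at t)" "continuous_on UNIV k" "\<And>t. \<psi> (t + 1) = \<psi> t"
    "\<And>t. \<bar>1 + k t\<bar> \<le> 2 * pi / (\<epsilon> * ln (1 / \<epsilon>))"
    "\<And>t. \<bar>sin (2 * pi * t)\<bar> * \<bar>1 + k t\<bar> \<le> 2 * pi / ln (1 / \<epsilon>)"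
proof -
  define h where "h t = 1 / (\<epsilon> + \<bar>sin (2 * pi * t)\<bar>)" for t
  have pos: "0 < \<epsilon> + \<bar>sin (2 * pi * t)\<bar>" for t using assms by simp
  have h_pos: "0 < h t" for t unfolding h_def using pos by simp
  have h_cont: "continuous_on UNIV h"
    unfolding h_def using pos by (intro continuous_intros) (auto simp: less_imp_neq[THEN not_sym])
  then obtain U where U: "\<And>t. (U has_real_derivative h t) (at t)"
    using einterval_antiderivative[of "-\<infinity>" "\<infinity>" h]
    by (auto simp: continuous_on_eq_continuous_at has_real_derivative_iff_has_vector_derivative)
  \<comment> \<open>The climb of \<open>U\<close> over one period; dividing by it makes
    \<open>U t / J - t\<close> periodic.\<close>
  define J where "J = U 1 - U 0"
  have h_per: "h (t + 1) = h t" for t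
  proof -
    have "sin (2 * pi * (t + 1)) = sin (2 * pi * t)"
      using sin_periodic[of "2 * pi * t"] by (simp add: algebra_simps)
    then show ?thesis by (simp add: h_def)
  qed
  have "((\<lambda>t. U (t + 1) - U t) has_real_derivative 0) (at t)" for t
  proof -
    have "((\<lambda>t. U (t + 1)) has_real_derivative h (t + 1)) (at t)"
      using U[of "t + 1"] by (simp add: DERIV_shift)
    from DERIV_diff[OF this U[of t]] show ?thesis by (simp add: h_per)
  qed
  then have shift: "U (t + 1) - U t = U (0 + 1) - U 0" for t
    using DERIV_isconst_all[of "\<lambda>t. U (t + 1) - U t" t 0] by blast
  have U_per: "U (t + 1) = U t + J" for t
    using shift[of t] by (simp add: J_def)
  have mono: "U (1/4) \<le> U 1"
    using U h_pos by (intro DERIV_nonneg_imp_nondecreasing[of "1/4" 1 U]) (auto intro: less_imp_le)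
  \<comment> \<open>Since \<open>\<bar>sin s\<bar> \<le> \<bar>s\<bar>\<close>, the slope
    \<open>h t\<close> is at least \<open>1 / (\<epsilon> + 2 * pi * t)\<close>, and integrating
    this over a quarter period gives the logarithm in the lower bound for \<open>J\<close>.\<close>
  have "U 0 - ln (\<epsilon> + 2 * pi * 0) / (2 * pi) \<le> U (1/4) - ln (\<epsilon> + 2 * pi * (1/4)) / (2 * pi)"
  proof (rule DERIV_nonneg_imp_nondecreasing[where f = "\<lambda>t. U t - ln (\<epsilon> + 2 * pi * t) / (2 * pi)"])
    fix t :: real assume t: "0 \<le> t" "t \<le> 1/4"
    have "0 < \<epsilon> + 2 * pi * t" using assms t by (simp add: add_pos_nonneg)
    then have "((\<lambda>t. ln (\<epsilon> + 2 * pi * t) / (2 * pi)) has_real_derivative 1 / (\<epsilon> + 2 * pi * t)) (at t)"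
      by (auto intro!: derivative_eq_intros)
    from DERIV_diff[OF U this]
    have "((\<lambda>t. U t - ln (\<epsilon> + 2 * pi * t) / (2 * pi)) has_real_derivative
        h t - 1 / (\<epsilon> + 2 * pi * t)) (at t)" .
    moreover have "1 / (\<epsilon> + 2 * pi * t) \<le> h t"
      unfolding h_def using pos[of t] abs_sin_x_le_abs_x[of "2 * pi * t"] t
      by (intro divide_left_mono) (auto simp: abs_mult intro!: mult_pos_pos add_pos_nonneg assms)
    ultimately show "\<exists>y. ((\<lambda>t. U t - ln (\<epsilon> + 2 * pi * t) / (2 * pi)) has_real_derivative y) (at t) \<and> 0 \<le> y"
      by (intro exI[of _ "h t - 1 / (\<epsilon> + 2 * pi * t)"]) auto
  qed simp
  then have "(ln (\<epsilon> + pi / 2) - ln \<epsilon>) / (2 * pi) \<le> J"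
    using mono by (simp add: J_def diff_divide_distrib)
  moreover have "0 \<le> ln (\<epsilon> + pi / 2)" using assms pi_ge_two by (intro ln_ge_zero) linarith
  then have "ln (1 / \<epsilon>) / (2 * pi) \<le> (ln (\<epsilon> + pi / 2) - ln \<epsilon>) / (2 * pi)"
    using assms by (intro divide_right_mono) (auto simp: ln_div)
  ultimately have J: "ln (1 / \<epsilon>) / (2 * pi) \<le> J" by simp
  have l: "0 < ln (1 / \<epsilon>)" using assms by (intro ln_gt_zero) (simp add: field_simps)
  then have "0 < ln (1 / \<epsilon>) / (2 * pi)" by simp
  then have "0 < J" using J by linarith
  have J_inv: "1 / J \<le> 2 * pi / ln (1 / \<epsilon>)"
    using J l \<open>0 < J\<close> by (simp add: field_simps)
  show ?thesis
  proof
    \<comment> \<open>Here \<open>1 + k t = h t / J\<close>; the two estimates then follow from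
      \<open>h t \<le> 1 / \<epsilon>\<close> and
      \<open>\<bar>sin (2 * pi * t)\<bar> * h t \<le> 1\<close>.\<close>
    show "((\<lambda>t. U t / J - t) has_real_derivative (h t / J - 1)) (at t)" for t
      using \<open>0 < J\<close> by (auto intro!: derivative_eq_intros U)
    show "continuous_on UNIV (\<lambda>t. h t / J - 1)"
      using \<open>0 < J\<close> by (intro continuous_intros h_cont) auto
    show "U (t + 1) / J - (t + 1) = U t / J - t" for t
      using \<open>0 < J\<close> by (simp add: U_per add_divide_distrib)
    fix t
    have eq: "\<bar>1 + (h t / J - 1)\<bar> = h t * (1 / J)" using h_pos[of t] \<open>0 < J\<close> by simp
    have "h t \<le> 1 / \<epsilon>" unfolding h_def using assms by (intro divide_left_mono) (auto intro!: mult_pos_pos add_pos_nonneg)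
    then have "h t * (1 / J) \<le> (1 / \<epsilon>) * (2 * pi / ln (1 / \<epsilon>))"
      using J_inv \<open>0 < J\<close> assms by (intro mult_mono) auto
    then show "\<bar>1 + (h t / J - 1)\<bar> \<le> 2 * pi / (\<epsilon> * ln (1 / \<epsilon>))" unfolding eq by simp
    have "\<bar>sin (2 * pi * t)\<bar> * h t \<le> 1"
      unfolding h_def using pos[of t] assms by (simp add: field_simps)
    then have "\<bar>sin (2 * pi * t)\<bar> * h t * (1 / J) \<le> 1 * (2 * pi / ln (1 / \<epsilon>))"
      using J_inv \<open>0 < J\<close> by (intro mult_mono) auto
    then show "\<bar>sin (2 * pi * t)\<bar> * \<bar>1 + (h t / J - 1)\<bar> \<le> 2 * pi / ln (1 / \<epsilon>)" unfolding eq by simp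
  qed
qed

lemma C1_with_gradient_coordinate:
  assumes "\<And>t. (\<psi> has_real_derivative k t) (at t)" "continuous_on UNIV k"
  shows "C1_with_gradient (\<lambda>x. c * \<psi> (x $ i)) (\<lambda>x. (c * k (x $ i)) *\<^sub>R axis i 1)"
  unfolding C1_with_gradient_def
proof (intro conjI allI)
  show "continuous_on UNIV (\<lambda>x. (c * k (x $ i)) *\<^sub>R axis i 1 :: real^2)"
    by (intro continuous_intros continuous_on_compose2[OF assms(2)]) auto
  fix x :: "real^2"
  have "((\<lambda>x::real^2. x $ i) has_derivative (\<lambda>h. h $ i)) (at x)"
    by (rule bounded_linear_imp_has_derivative[OF bounded_linear_vec_nth])
  then have "((\<lambda>x. \<psi> (x $ i)) has_derivative (\<lambda>h. h $ i * k (x $ i))) (at x)"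
    using has_derivative_compose[of "\<lambda>x::real^2. x $ i" "\<lambda>h. h $ i" x UNIV \<psi> "times (k (x $ i))"]
      assms(1)[of "x $ i", unfolded has_field_derivative_def] by (simp add: mult.commute)
  from has_derivative_mult_right[OF this, of c]
  show "((\<lambda>x. c * \<psi> (x $ i)) has_derivative (\<lambda>h. ((c * k (x $ i)) *\<^sub>R axis i 1) \<bullet> h)) (at x)"
    by (simp add: inner_axis' mult_ac)
qed

section \<open>General bounds for the effective Hamiltonian\<close>

text \<open>The square dominates the linear drift: with \<open>n = norm (p + q)\<close> and
  \<open>norm (V x) \<le> M\<close>, the sublevel condition gives
  \<open>n * (n - \<bar>A\<bar> * M) \<le> c\<close>.\<close>

lemma coercive_hamiltonian_drift:
  fixes V :: "real^2 \<Rightarrow> real^2"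
  assumes V: "continuous_on UNIV V" "torus_periodic V"
  shows "coercive_hamiltonian (\<lambda>x q. (norm (p + q))\<^sup>2 + A * (V x \<bullet> (p + q)))"
proof
  show "continuous_on UNIV (\<lambda>(x, q). (norm (p + q))\<^sup>2 + A * (V x \<bullet> (p + q)))"
    unfolding case_prod_beta' by (intro continuous_intros continuous_on_compose2[OF V(1)]) auto
  show "torus_periodic (\<lambda>x. (norm (p + q))\<^sup>2 + A * (V x \<bullet> (p + q)))" for q
    using V(2) by (simp add: torus_periodic_def)
  fix c
  have "torus_periodic (\<lambda>x. norm (V x))" using V(2) by (simp add: torus_periodic_def)
  then obtain M where M: "\<And>x. \<bar>norm (V x)\<bar> \<le> M"
    by (rule torus_periodic_bounded[OF continuous_on_norm[OF V(1)]]) (rule that)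
  have "0 \<le> M" using M[of 0] norm_ge_zero[of "V 0"] by linarith
  show "\<exists>R\<ge>0. \<forall>x q. (norm (p + q))\<^sup>2 + A * (V x \<bullet> (p + q)) \<le> c \<longrightarrow> norm q \<le> R"
  proof (intro exI[of _ "\<bar>A\<bar> * M + \<bar>c\<bar> + 1 + norm p"] conjI allI impI)
    show "0 \<le> \<bar>A\<bar> * M + \<bar>c\<bar> + 1 + norm p" using \<open>0 \<le> M\<close> by simp
    fix x q assume le: "(norm (p + q))\<^sup>2 + A * (V x \<bullet> (p + q)) \<le> c"
    define n where "n = norm (p + q)"
    have "\<bar>A * (V x \<bullet> (p + q))\<bar> \<le> \<bar>A\<bar> * (M * n)"
      unfolding abs_mult n_def using M[of x]
      by (intro mult_left_mono order_trans[OF Cauchy_Schwarz_ineq2] mult_right_mono) auto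
    then have *: "n * n - \<bar>A\<bar> * M * n \<le> c" using le by (simp add: n_def power2_eq_square)
    have "n \<le> \<bar>A\<bar> * M + \<bar>c\<bar> + 1"
    proof (rule ccontr)
      assume "\<not> ?thesis"
      then have n: "\<bar>c\<bar> + 1 < n - \<bar>A\<bar> * M" by simp
      moreover have "0 \<le> \<bar>A\<bar> * M" using \<open>0 \<le> M\<close> by simp
      ultimately have "1 < n" by linarith
      then have "1 * (\<bar>c\<bar> + 1) \<le> n * (n - \<bar>A\<bar> * M)" using n by (intro mult_mono) auto
      then show False using * by (simp add: algebra_simps)
    qed
    moreover have "norm q \<le> n + norm p" unfolding n_def
      using norm_triangle_ineq4[of "p + q" p] by simp
    ultimately show "norm q \<le> \<bar>A\<bar> * M + \<bar>c\<bar> + 1 + norm p" by simp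
  qed
qed

lemma effective_hamiltonian_solution:
  fixes V :: "real^2 \<Rightarrow> real^2"
  assumes "continuous_on UNIV V" "torus_periodic V"
  obtains F where "torus_periodic F"
    "viscosity_solution (\<lambda>x q. (norm (p + q))\<^sup>2 + A * (V x \<bullet> (p + q))) (effective_hamiltonian V A p) F"
proof -
  interpret coercive_hamiltonian "\<lambda>x q. (norm (p + q))\<^sup>2 + A * (V x \<bullet> (p + q))"
    by (rule coercive_hamiltonian_drift[OF assms])
  from theI'[OF ex1_cell_problem] show ?thesis
    using that unfolding effective_hamiltonian_def by blast
qed

lemma effective_hamiltonian_nonneg:
  fixes V :: "real^2 \<Rightarrow> real^2"
  assumes "continuous_on UNIV V" "torus_periodic V" "V x = 0"
  shows "0 \<le> effective_hamiltonian V A p"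
proof -
  interpret coercive_hamiltonian "\<lambda>x q. (norm (p + q))\<^sup>2 + A * (V x \<bullet> (p + q))"
    by (rule coercive_hamiltonian_drift[OF assms(1,2)])
  obtain F where "viscosity_solution (\<lambda>x q. (norm (p + q))\<^sup>2 + A * (V x \<bullet> (p + q)))
      (effective_hamiltonian V A p) F"
    using effective_hamiltonian_solution[OF assms(1,2)] by blast
  then show ?thesis
    using subsolution_ge[of F _ 0 x] assms(3) unfolding viscosity_solution_def by simp
qed

text \<open>The upper half of the inf-max formula: \<open>\<phi>\<close> is a classical, hence a
  viscosity subsolution, and is compared with a solution of the cell problem.\<close>

lemma effective_hamiltonian_le:
  fixes V :: "real^2 \<Rightarrow> real^2"
  assumes V: "continuous_on UNIV V" "torus_periodic V"
    and \<phi>: "C1_with_gradient \<phi> g" "torus_periodic \<phi>"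
    and le: "\<And>x. (norm (p + g x))\<^sup>2 + A * (V x \<bullet> (p + g x)) \<le> c"
  shows "effective_hamiltonian V A p \<le> c"
proof -
  interpret coercive_hamiltonian "\<lambda>x q. (norm (p + q))\<^sup>2 + A * (V x \<bullet> (p + q))"
    by (rule coercive_hamiltonian_drift[OF V])
  obtain F where "torus_periodic F" "viscosity_solution (\<lambda>x q. (norm (p + q))\<^sup>2 + A * (V x \<bullet> (p + q)))
      (effective_hamiltonian V A p) F"
    using effective_hamiltonian_solution[OF V] by blast
  moreover have "viscosity_subsolution (\<lambda>x q. (norm (p + q))\<^sup>2 + A * (V x \<bullet> (p + q))) c \<phi>"
    by (rule viscosity_subsolution_C1[OF \<phi>(1)]) (rule le)
  ultimately show ?thesis
    using supersolution_le_subsolution[OF C1_with_gradient_continuous_on[OF \<phi>(1)] \<phi>(2)]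
    unfolding viscosity_solution_def by blast
qed

section \<open>The logarithmic bound for the cellular flow\<close>

text \<open>The squared gradient contributes \<open>16 * pi\<^sup>2 * (A / (ln A)\<^sup>2)\<close>
  and the drift \<open>16 * pi\<^sup>2 * (A / ln A)\<close>. The threshold \<open>exp 1\<close>
  ensures \<open>ln A \<ge> 1\<close>, so the first is at most the second.\<close>

lemma effective_hamiltonian_cellular_le:
  assumes "exp 1 \<le> A" "norm p = 1"
  shows "effective_hamiltonian cellular_flow A p \<le> 32 * pi\<^sup>2 * (A / ln A)"
proof -
  have "0 < A" using assms(1) exp_gt_zero[of 1] by linarith
  have lnA: "1 \<le> ln A" using assms(1) \<open>0 < A\<close> by (simp add: ln_ge_iff)
  then have "0 < ln A" by simp
  have "1 < A" using assms(1) exp_ge_add_one_self[of 1] by linarith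
  define \<epsilon> where "\<epsilon> = 1 / sqrt A"
  have \<epsilon>: "0 < \<epsilon>" "\<epsilon> < 1" "\<epsilon>\<^sup>2 = 1 / A" "ln (1 / \<epsilon>) = ln A / 2"
    using \<open>1 < A\<close> by (auto simp: \<epsilon>_def power_divide ln_sqrt)
  define a where "a = 2 * pi / (\<epsilon> * (ln A / 2))"
  define b where "b = 2 * pi / (ln A / 2)"
  obtain \<psi> k where \<psi>: "\<And>t. (\<psi> has_real_derivative k t) (at t)" "continuous_on UNIV k"
    and per: "\<And>t. \<psi> (t + 1) = \<psi> t"
    and a: "\<And>t. \<bar>1 + k t\<bar> \<le> a" and b: "\<And>t. \<bar>sin (2 * pi * t)\<bar> * \<bar>1 + k t\<bar> \<le> b"
    using log_profile[OF \<epsilon>(1,2)] unfolding \<epsilon>(4) a_def b_def by metis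
  interpret periodic_fun_simple' \<psi> by unfold_locales (rule per)
  have p: "(p $ 1)\<^sup>2 + (p $ 2)\<^sup>2 = 1" using assms(2) norm_vec2_squared[of p] by simp
  have p1: "\<bar>p $ i\<bar> \<le> 1" for i using component_le_norm_cart[of p i] assms(2) by simp
  \<comment> \<open>With this corrector, \<open>p + g x\<close> has the components
    \<open>p $ i * (1 + k (x $ i))\<close>, multiples of the slopes of the profile.\<close>
  define \<phi> where "\<phi> x = p $ 1 * \<psi> (x $ 1) + p $ 2 * \<psi> (x $ 2)" for x :: "real^2"
  define g :: "real^2 \<Rightarrow> real^2" where "g x = (p $ 1 * k (x $ 1)) *\<^sub>R axis 1 1 + (p $ 2 * k (x $ 2)) *\<^sub>R axis 2 1" for x
  have "effective_hamiltonian cellular_flow A p \<le> a\<^sup>2 + A * (2 * pi * b + 2 * pi * b)"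
  proof (rule effective_hamiltonian_le[OF cellular_flow_continuous cellular_flow_periodic])
    show "C1_with_gradient \<phi> g"
      unfolding \<phi>_def g_def by (intro C1_with_gradient_add C1_with_gradient_coordinate \<psi>)
    show "torus_periodic \<phi>"
      unfolding torus_periodic_def
    proof (intro allI impI)
      fix x n :: "real^2" assume n: "\<forall>i. n $ i \<in> \<int>"
      have "\<psi> (x $ i + n $ i) = \<psi> (x $ i)" for i
        using n Ints_cases plus_of_int by metis
      then show "\<phi> (x + n) = \<phi> x" by (simp add: \<phi>_def)
    qed
    fix x :: "real^2"
    have comp: "(p + g x) $ i = p $ i * (1 + k (x $ i))" for i
      using exhaust_2[of i] by (auto simp: g_def axis_def algebra_simps)
    have sq: "((p + g x) $ i)\<^sup>2 \<le> (p $ i)\<^sup>2 * a\<^sup>2" for i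
      unfolding comp power_mult_distrib using a[of "x $ i"]
      by (intro mult_left_mono) (auto intro: abs_le_square_iff[THEN iffD1] simp: power2_le_iff_abs_le)
    have "(norm (p + g x))\<^sup>2 \<le> (p $ 1)\<^sup>2 * a\<^sup>2 + (p $ 2)\<^sup>2 * a\<^sup>2"
      unfolding norm_vec2_squared by (intro add_mono sq)
    also have "\<dots> = a\<^sup>2" using p by (simp flip: distrib_right)
    finally have 1: "(norm (p + g x))\<^sup>2 \<le> a\<^sup>2" .
    \<comment> \<open>The flow component in direction \<open>i\<close> carries the factor
      \<open>sin (2 * pi * x $ i)\<close>, which is small where the slope in that direction is
      large; the other factor is a cosine. This pairing gives \<open>b\<close> in place of the
      larger \<open>a\<close>.\<close>
    have drift: "\<bar>2 * pi * (sin (2 * pi * x $ i) * (p + g x) $ i * c)\<bar> \<le> 2 * pi * b"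
      if "\<bar>c\<bar> \<le> 1" for i c
    proof -
      have "\<bar>sin (2 * pi * x $ i) * (p + g x) $ i * c\<bar>
          = (\<bar>sin (2 * pi * x $ i)\<bar> * \<bar>1 + k (x $ i)\<bar>) * (\<bar>p $ i\<bar> * \<bar>c\<bar>)"
        unfolding comp by (simp add: abs_mult)
      also have "\<dots> \<le> b * (1 * 1)"
        using b[of "x $ i"] p1[of i] that by (intro mult_mono) (auto intro: order_trans[OF _ b[of "x $ i"]])
      finally show ?thesis by (simp add: abs_mult)
    qed
    have "cellular_flow x \<bullet> (p + g x)
        = - (2 * pi * (sin (2 * pi * x $ 1) * (p + g x) $ 1 * cos (2 * pi * x $ 2)))
          + 2 * pi * (sin (2 * pi * x $ 2) * (p + g x) $ 2 * cos (2 * pi * x $ 1))"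
      unfolding cellular_flow_eq inner_add_left inner_scaleR_left inner_axis' by simp
    also have "\<dots> \<le> 2 * pi * b + 2 * pi * b"
      using drift[OF abs_cos_le_one[of "2 * pi * x $ 2"], of 1]
        drift[OF abs_cos_le_one[of "2 * pi * x $ 1"], of 2] by linarith
    finally show "(norm (p + g x))\<^sup>2 + A * (cellular_flow x \<bullet> (p + g x)) \<le> a\<^sup>2 + A * (2 * pi * b + 2 * pi * b)"
      using 1 \<open>0 < A\<close> by (intro add_mono mult_left_mono) auto
  qed
  also have "a\<^sup>2 = 16 * pi\<^sup>2 * (A / (ln A)\<^sup>2)"
    unfolding a_def power_divide power_mult_distrib \<epsilon>(3) using \<open>0 < A\<close> by (simp add: field_simps)
  also have "\<dots> \<le> 16 * pi\<^sup>2 * (A / ln A)"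
    using lnA \<open>0 < ln A\<close> \<open>0 < A\<close> self_le_power[of "ln A" 2]
    by (intro mult_left_mono divide_left_mono mult_pos_pos zero_less_power) auto
  also have "A * (2 * pi * b + 2 * pi * b) = 16 * pi\<^sup>2 * (A / ln A)"
    unfolding b_def by (simp add: power2_eq_square)
  finally show ?thesis by (simp add: mult_ac)
qed

section \<open>The flame speed\<close>

lemma KPP_nonlinearity_deriv_pos:
  assumes "KPP_nonlinearity f"
  shows "0 < deriv01 f 0"
proof -
  have "0 < f (1/2)" "f (1/2) \<le> 1/2 * deriv01 f 0"
    using assms unfolding KPP_nonlinearity_def by (auto dest!: bspec[of _ _ "1/2"])
  then show ?thesis by simp
qed

theorem theorem3p4:
  fixes f :: "real \<Rightarrow> real" and p :: "real^2"
  assumes "KPP_nonlinearity f"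
    and "norm p = 1"
  shows "(\<lambda>A. flame_speed f cellular_flow A p) \<in> O[at_top](\<lambda>A. A / ln A) \<and>
         (\<lambda>A. effective_hamiltonian cellular_flow A p) \<in> O[at_top](\<lambda>A. A / ln A)"
proof
  define H where "H A q = effective_hamiltonian cellular_flow A q" for A q
  have "cellular_flow 0 = 0" by (simp add: cellular_flow_eq)
  then have H_nonneg: "0 \<le> H A q" for A q
    unfolding H_def
    by (intro effective_hamiltonian_nonneg cellular_flow_continuous cellular_flow_periodic)
  have H_le: "H A p \<le> 32 * pi\<^sup>2 * (A / ln A)" if "exp 1 \<le> A" for A
    unfolding H_def by (rule effective_hamiltonian_cellular_le[OF that assms(2)])
  have large: "\<forall>\<^sub>F A in at_top. exp 1 \<le> (A::real)" by (rule eventually_ge_at_top)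
  show H_bigo: "(\<lambda>A. effective_hamiltonian cellular_flow A p) \<in> O[at_top](\<lambda>A. A / ln A)"
    unfolding H_def[symmetric]
  proof (rule bigoI)
    show "\<forall>\<^sub>F A in at_top. norm (H A p) \<le> 32 * pi\<^sup>2 * norm (A / ln A)"
      using large
    proof eventually_elim
      case (elim A)
      have "32 * pi\<^sup>2 * (A / ln A) \<le> 32 * pi\<^sup>2 * norm (A / ln A)"
        by (intro mult_left_mono) (simp_all only: real_norm_def abs_ge_self zero_le_mult_iff, simp_all)
      then show ?case using H_le[OF elim] H_nonneg[of A p] by simp
    qed
  qed
  define d where "d = deriv01 f 0"
  have "0 < d" unfolding d_def by (rule KPP_nonlinearity_deriv_pos[OF assms(1)])
  have speed: "0 \<le> flame_speed f cellular_flow A p" "flame_speed f cellular_flow A p \<le> d + H A p" for A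
  proof -
    \<comment> \<open>Bounds the family below by 0, so that its infimum can be estimated by the
      member with \<open>l = 1\<close>.\<close>
    have nonneg: "0 \<le> (d + H A (l *\<^sub>R p)) / l" if "0 < l" for l
      using H_nonneg[of A "l *\<^sub>R p"] \<open>0 < d\<close> that by simp
    show "0 \<le> flame_speed f cellular_flow A p"
      unfolding flame_speed_def H_def[symmetric] d_def[symmetric]
      by (intro cINF_greatest) (auto simp: nonneg)
    have "bdd_below ((\<lambda>l. (d + H A (l *\<^sub>R p)) / l) ` {0<..})"
      by (rule bdd_belowI[of _ 0]) (use nonneg in auto)
    then have "flame_speed f cellular_flow A p \<le> (d + H A (1 *\<^sub>R p)) / 1"
      unfolding flame_speed_def H_def[symmetric] d_def[symmetric] by (intro cINF_lower) auto
    then show "flame_speed f cellular_flow A p \<le> d + H A p" by simp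
  qed
  \<comment> \<open>The constant \<open>d\<close> is absorbed because \<open>A / ln A\<close> tends
    to infinity.\<close>
  have "(\<lambda>A. d + H A p) \<in> O[at_top](\<lambda>A. A / ln A)"
  proof (rule sum_in_bigo)
    show "(\<lambda>A. d) \<in> O[at_top](\<lambda>A. A / ln A)" by real_asymp
    show "(\<lambda>A. H A p) \<in> O[at_top](\<lambda>A. A / ln A)" using H_bigo by (simp add: H_def)
  qed
  moreover have "(\<lambda>A. flame_speed f cellular_flow A p) \<in> O[at_top](\<lambda>A. d + H A p)"
  proof (rule bigoI[of _ 1], rule always_eventually, rule allI)
    show "norm (flame_speed f cellular_flow A p) \<le> 1 * norm (d + H A p)" for A
      using speed[of A] by simp
  qed
  ultimately show "(\<lambda>A. flame_speed f cellular_flow A p) \<in> O[at_top](\<lambda>A. A / ln A)"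
    by (rule landau_o.big_trans[rotated])
qed

end
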